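(* Let $m\ge4$ be an even integer, let $G=\mathbf{GL}_m^+(\mathbf R)$ be the group of real $m\times m$ matrices with positive determinant, and let $X=\mathbf{P}\mathbf{R}^m$ be the projective space with its natural $G$-action. Then there does not exist a family $(\lambda_p)_{p\ge1}$ of $G$-equivariant strong linear liftings $\lambda_p\colon L^\infty(X^p)\to\mathscr{L}^\infty(X^p)$ (for the diagonal $G$-action on $X^p$) such that: (i) $\lambda_{p+1}(d\varphi)=d(\lambda_p\varphi)$ for all $p\ge1$ and all $\varphi\in L^\infty(X^p)$, where $d$ denotes the homogeneous coboundary maps $L^\infty(X^p)\to L^\infty(X^{p+1})$ and $\mathscr{L}^\infty(X^p)\to\mathscr{L}^\infty(X^{p+1})$; and (ii) each $\lambda_p$ commutes with the action of the symmetric group on $p$ letters by permutation of the coordinates of $X^p$.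
   Context: Measure: the manifolds $X^p$ are endowed with the Lebesgue measure associated to some Riemannian structure (the spaces below do not depend on the choice). Function spaces: for such a manifold $Y$, $\mathscr{L}^\infty(Y)$ is the space of (everywhere defined) bounded Lebesgue-measurable functions on $Y$, with the sup-norm; $L^\infty(Y)$ is the space of classes $[f]$ of such functions modulo almost everywhere equality. Linear lifting: a positive linear map $\lambda\colon L^\infty(Y)\to\mathscr{L}^\infty(Y)$ such that $\lambda(\varphi)\in\varphi$ for all $\varphi\in L^\infty(Y)$ and $\lambda([\mathbf 1_Y])=\mathbf 1_Y$. It is strong if $\lambda([f])=f$ for every continuous function $f$ on $Y$. Equivariance is with respect to $(sf)(y)=f(s^{-1}y)$. Homogeneous coboundary: $d=\sum_{j=0}^p(-1)^jd_j$, where $(d_jf)(x_0,\ldots,x_p)=f(x_0,\ldots,\widehat{x_j},\ldots,x_p)$ omits the $j$-th coordinate; the same formula defines $d$ on function classes. *)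

theory Defs
  imports "HOL-Analysis.Analysis"
begin

section \<open>Bounded measurable functions, their classes, and linear liftings\<close>

text \<open>
  A function on \<open>Y\<close> is a HOL function that is extensional on \<open>space M\<close> (it has the value
  \<open>undefined\<close> elsewhere), so that equality of HOL functions is equality of functions on \<open>Y\<close>.
  Lebesgue measurability is measurability for a complete measure \<open>M\<close>.
\<close>

definition bounded_meas :: "'a measure \<Rightarrow> ('a \<Rightarrow> real) set" where
  "bounded_meas M =
     {f \<in> borel_measurable M. f \<in> extensional (space M) \<and> bounded (f ` space M)}"

definition ae_rel :: "'a measure \<Rightarrow> (('a \<Rightarrow> real) \<times> ('a \<Rightarrow> real)) set" where
  "ae_rel M =
     {(f, g). f \<in> bounded_meas M \<and> g \<in> bounded_meas M \<and> (AE x in M. f x = g x)}"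

definition Linf :: "'a measure \<Rightarrow> ('a \<Rightarrow> real) set set" where
  "Linf M = bounded_meas M // ae_rel M"

definition ae_class :: "'a measure \<Rightarrow> ('a \<Rightarrow> real) \<Rightarrow> ('a \<Rightarrow> real) set" where
  "ae_class M f = ae_rel M `` {f}"

lemma equiv_ae_rel: "equiv (bounded_meas M) (ae_rel M)"
proof (rule equivI)
  show "ae_rel M \<subseteq> bounded_meas M \<times> bounded_meas M"
    by (auto simp: ae_rel_def)
  show "refl_on (bounded_meas M) (ae_rel M)"
    by (simp add: ae_rel_def refl_on_def)
  show "sym (ae_rel M)"
    by (simp add: ae_rel_def sym_def eq_commute)
  show "trans (ae_rel M)"
    unfolding ae_rel_def by (rule transI) (auto elim: AE_mp)
qed

text \<open>
  The vector space structure, the order, and all operators on classes are the ones induced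
  by representatives; conditions on \<open>\<phi> \<in> Linf M\<close> involving them are therefore written
  with \<open>\<phi> = ae_class M f\<close>.
\<close>

definition linear_lifting :: "'a measure \<Rightarrow> (('a \<Rightarrow> real) set \<Rightarrow> ('a \<Rightarrow> real)) \<Rightarrow> bool" where
  "linear_lifting M \<Lambda> \<longleftrightarrow>
     \<Lambda> \<in> Linf M \<rightarrow> bounded_meas M \<and>
     (\<forall>f\<in>bounded_meas M. \<forall>g\<in>bounded_meas M.
        \<Lambda> (ae_class M (\<lambda>x\<in>space M. f x + g x)) =
          (\<lambda>x\<in>space M. \<Lambda> (ae_class M f) x + \<Lambda> (ae_class M g) x)) \<and>
     (\<forall>c. \<forall>f\<in>bounded_meas M.
        \<Lambda> (ae_class M (\<lambda>x\<in>space M. c * f x)) =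
          (\<lambda>x\<in>space M. c * \<Lambda> (ae_class M f) x)) \<and>
     (\<forall>f\<in>bounded_meas M. (AE x in M. 0 \<le> f x) \<longrightarrow>
        (\<forall>x\<in>space M. 0 \<le> \<Lambda> (ae_class M f) x)) \<and>
     (\<forall>\<phi>\<in>Linf M. \<Lambda> \<phi> \<in> \<phi>) \<and>
     \<Lambda> (ae_class M (\<lambda>x\<in>space M. 1)) = (\<lambda>x\<in>space M. 1)"

definition strong_lifting ::
    "'a measure \<Rightarrow> 'a topology \<Rightarrow> (('a \<Rightarrow> real) set \<Rightarrow> ('a \<Rightarrow> real)) \<Rightarrow> bool" where
  "strong_lifting M T \<Lambda> \<longleftrightarrow>
     (\<forall>f\<in>extensional (space M). continuous_map T euclideanreal f \<longrightarrow>
        \<Lambda> (ae_class M f) = f)"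

section \<open>Real projective space\<close>

typedef (overloaded) ('m::finite) proj = "{L :: (real^'m) set. subspace L \<and> dim L = 1}"
proof -
  have "axis undefined 1 \<noteq> (0 :: real^'m)"
    by (simp add: axis_eq_0_iff)
  then have "dim (span {axis undefined 1 :: real^'m}) = 1"
    by simp
  then show ?thesis
    by (intro exI[of _ "span {axis undefined 1}"]) simp
qed

text \<open>Only meaningful for \<open>v \<noteq> 0\<close>.\<close>

definition proj_point :: "real^'m \<Rightarrow> 'm::finite proj" where
  "proj_point v = Abs_proj (span {v})"

text \<open>The quotient topology from the nonzero vectors.\<close>

instantiation proj :: (finite) topological_space
begin

definition open_proj :: "'a proj set \<Rightarrow> bool" where
  "open_proj U \<longleftrightarrow> open {v :: real^'a. v \<noteq> 0 \<and> proj_point v \<in> U}"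

instance
proof
  have "{v :: real^'a. v \<noteq> 0 \<and> proj_point v \<in> UNIV} = - {0}"
    by auto
  then show "open (UNIV :: 'a proj set)"
    unfolding open_proj_def by (simp add: open_Compl)
next
  fix S T :: "'a proj set"
  assume "open S" "open T"
  moreover have "{v :: real^'a. v \<noteq> 0 \<and> proj_point v \<in> S \<inter> T} =
      {v. v \<noteq> 0 \<and> proj_point v \<in> S} \<inter> {v. v \<noteq> 0 \<and> proj_point v \<in> T}"
    by auto
  ultimately show "open (S \<inter> T)"
    unfolding open_proj_def by (simp add: open_Int)
next
  fix K :: "'a proj set set"
  assume "\<forall>S\<in>K. open S"
  moreover have "{v :: real^'a. v \<noteq> 0 \<and> proj_point v \<in> \<Union>K} =
      (\<Union>S\<in>K. {v. v \<noteq> 0 \<and> proj_point v \<in> S})"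
    by auto
  ultimately show "open (\<Union>K)"
    by (simp only: open_proj_def) (rule open_UN, simp)
qed

end

text \<open>Only meaningful for invertible \<open>s\<close>.\<close>

definition proj_act :: "real^'m^'m \<Rightarrow> 'm::finite proj \<Rightarrow> 'm proj" where
  "proj_act s L = Abs_proj ((*v) s ` Rep_proj L)"

text \<open>
  The image of Lebesgue measure on the punctured unit ball. Being finite and invariant under
  the orthogonal group, it is a multiple of the Riemannian measure of the round metric.
\<close>

definition proj_measure :: "'m::finite proj measure" where
  "proj_measure = distr (restrict_space lborel (ball (0 :: real^'m) 1 - {0})) borel proj_point"

lemma measurable_proj_point:
  "proj_point \<in> restrict_space lborel (ball (0 :: real^'m::finite) 1 - {0}) \<rightarrow>\<^sub>M borel"
proof (rule borel_measurableI)
  fix U :: "'m proj set"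
  assume "open U"
  then have "open {v :: real^'m. v \<noteq> 0 \<and> proj_point v \<in> U}"
    by (simp add: open_proj_def)
  then have "ball 0 1 \<inter> {v :: real^'m. v \<noteq> 0 \<and> proj_point v \<in> U} \<in> sets borel"
    by (intro borel_open open_Int open_ball)
  moreover have "proj_point -` U \<inter> space (restrict_space lborel (ball (0 :: real^'m) 1 - {0})) =
      ball 0 1 \<inter> {v. v \<noteq> 0 \<and> proj_point v \<in> U}"
    by (auto simp: space_restrict_space)
  ultimately show "proj_point -` U \<inter> space (restrict_space lborel (ball (0 :: real^'m) 1 - {0}))
      \<in> sets (restrict_space lborel (ball (0 :: real^'m) 1 - {0}))"
    by (subst sets_restrict_space_iff) auto
qed

section \<open>Powers of projective space\<close>

text \<open>
  A point \<open>(x\<^sub>0, \<dots>, x\<^bsub>p-1\<^esub>)\<close> of the \<open>p\<close>-th power is an extensional function on \<open>{..<p}\<close>.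
  Completing the product measure gives Lebesgue (rather than Borel) measurability.
\<close>

definition proj_pow :: "nat \<Rightarrow> (nat \<Rightarrow> 'm::finite proj) measure" where
  "proj_pow p = completion (PiM {..<p} (\<lambda>_. proj_measure))"

definition proj_pow_top :: "nat \<Rightarrow> (nat \<Rightarrow> 'm::finite proj) topology" where
  "proj_pow_top p = product_topology (\<lambda>_. euclidean) {..<p}"

lemma space_proj_pow: "space (proj_pow p) = ({..<p} \<rightarrow>\<^sub>E UNIV)"
  by (simp add: proj_pow_def proj_measure_def space_PiM)

lemma topspace_proj_pow_top: "topspace (proj_pow_top p) = space (proj_pow p)"
  by (simp add: proj_pow_top_def space_proj_pow)

definition GL_pos :: "(real^'m^'m) set" where
  "GL_pos = {s. 0 < det s}"

definition diag_act :: "nat \<Rightarrow> real^'m^'m \<Rightarrow> (nat \<Rightarrow> 'm::finite proj) \<Rightarrow> (nat \<Rightarrow> 'm proj)" where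
  "diag_act p s x = (\<lambda>i\<in>{..<p}. proj_act s (x i))"

definition translate ::
    "nat \<Rightarrow> real^'m^'m \<Rightarrow> ((nat \<Rightarrow> 'm::finite proj) \<Rightarrow> real) \<Rightarrow> ((nat \<Rightarrow> 'm proj) \<Rightarrow> real)" where
  "translate p s f = (\<lambda>x\<in>space (proj_pow p). f (diag_act p (matrix_inv s) x))"

definition permute_coords ::
    "nat \<Rightarrow> (nat \<Rightarrow> nat) \<Rightarrow> ((nat \<Rightarrow> 'm::finite proj) \<Rightarrow> real) \<Rightarrow> ((nat \<Rightarrow> 'm proj) \<Rightarrow> real)" where
  "permute_coords p \<sigma> f = (\<lambda>x\<in>space (proj_pow p). f (x \<circ> \<sigma>))"

definition omit :: "nat \<Rightarrow> nat \<Rightarrow> (nat \<Rightarrow> 'a) \<Rightarrow> (nat \<Rightarrow> 'a)" where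
  "omit p j x = (\<lambda>i\<in>{..<p}. if i < j then x i else x (Suc i))"

text \<open>From functions on the \<open>p\<close>-th power to functions on the \<open>(p+1)\<close>-st power.\<close>

definition coboundary ::
    "nat \<Rightarrow> ((nat \<Rightarrow> 'm::finite proj) \<Rightarrow> real) \<Rightarrow> ((nat \<Rightarrow> 'm proj) \<Rightarrow> real)" where
  "coboundary p f =
     (\<lambda>x\<in>space (proj_pow (Suc p)). \<Sum>j=0..p. (-1) ^ j * f (omit p j x))"

definition equivariant_lifting ::
    "nat \<Rightarrow> (((nat \<Rightarrow> 'm::finite proj) \<Rightarrow> real) set \<Rightarrow> ((nat \<Rightarrow> 'm proj) \<Rightarrow> real)) \<Rightarrow> bool" where
  "equivariant_lifting p \<Lambda> \<longleftrightarrow>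
     (\<forall>s\<in>GL_pos. \<forall>f\<in>bounded_meas (proj_pow p).
        \<Lambda> (ae_class (proj_pow p) (translate p s f)) =
          translate p s (\<Lambda> (ae_class (proj_pow p) f)))"

end

theory Submission
  imports Defs
begin

text \<open>
  For even \<open>m\<close> the orientation of \<open>m + 1\<close> points of the projective space of \<open>\<real>\<^sup>m\<close> in general position is
  an alternating, invariant function satisfying the cocycle relation almost everywhere (it
  represents the Euler class). Its lifting \<open>f\<close> is alternating, invariant and a cocycle at every
  point, so \<open>f\<close> vanishes at each tuple on which some matrix of positive determinant acts as a
  transposition. For a basis \<open>c\<close> chosen such that \<open>f\<close> is nonzero at the lines of
  \<open>c\<^sub>0, \<dots>, c\<^bsub>m-1\<^esub>, a\<close> with \<open>a = \<Sum>i. c\<^sub>i\<close>, all faces of the tuple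
  \<open>c\<^sub>0, \<dots>, c\<^bsub>m-1\<^esub>, a, c\<^sub>0 + c\<^sub>1\<close> except the one omitting the last point are of
  this kind when \<open>m \<ge> 4\<close>, which contradicts the cocycle relation.
\<close>

section \<open>Determinants of tuples of vectors\<close>

text \<open>A matrix fixing m + 1 lines in general position is a scalar t, and t^m > 0 when m is
  even; this is why generic tuples can carry a sign that G preserves. Degenerate tuples have larger
  stabilizers: a basis vector that does not enter the remaining point may change its sign, and this
  repairs the determinant of a matrix that swaps two lines. Degenerate tuples form a null set, so
  the class of the orientation says nothing about them; only the identities that the liftings carry
  over to every point do. Conversely, the value of f at a prescribed generic tuple is unknown, since
  f agrees with the orientation only almost everywhere. Hence the generic tuple is picked first, and
  the degenerate one is built around it by rescaling representatives. The bound m >= 4 comes from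
  the faces that omit \<open>c 0\<close> or \<open>c 1\<close>: the other of these two is flipped,
  so the swap has to use \<open>c 2\<close> and \<open>c 3\<close>.\<close>

definition rowdet :: "(nat \<Rightarrow> real^'m::finite) \<Rightarrow> real" where
  "rowdet u = det (\<chi> i. u (to_nat_on (UNIV :: 'm set) i))"

lemma bij_index: "bij_betw (to_nat_on (UNIV :: 'm::finite set)) UNIV {..<CARD('m)}"
  by (rule to_nat_on_finite) simp

lemma index_less: "to_nat_on (UNIV :: 'm::finite set) i < CARD('m)"
  using bij_index[where 'm='m] by (auto simp: bij_betw_def)

lemma index_eq_iff: "to_nat_on (UNIV :: 'm::finite set) i = to_nat_on UNIV j \<longleftrightarrow> i = j"
  using bij_index[where 'm='m] by (auto simp: bij_betw_def inj_on_def)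

lemma index_surj:
  assumes "j < CARD('m::finite)"
  obtains k :: "'m::finite" where "to_nat_on UNIV k = j"
proof -
  have "j \<in> range (to_nat_on (UNIV :: 'm set))"
    using bij_index[where 'm='m] assms by (auto simp: bij_betw_def)
  then show ?thesis
    using that by auto
qed

text \<open>Since entries beyond the dimension are ignored, longer tuples can be used without
  truncation, and faces and substitutions become compositions and function updates.\<close>

lemma rowdet_cong:
  fixes u v :: "nat \<Rightarrow> real^'m::finite"
  assumes "\<And>i. i < CARD('m) \<Longrightarrow> u i = v i"
  shows "rowdet u = rowdet v"
  by (simp add: rowdet_def assms index_less)

text \<open>Cramer's rule, with rows in place of columns. All later determinants are computed by
  reading off a coordinate in this way.\<close>

lemma rowdet_upd_sum:
  fixes u :: "nat \<Rightarrow> real^'m::finite"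
  assumes "j < CARD('m)"
  shows "rowdet (u(j := \<Sum>i<CARD('m). \<alpha> i *\<^sub>R u i)) = \<alpha> j * rowdet u"
proof -
  obtain k :: 'm where k: "to_nat_on UNIV k = j"
    using index_surj[OF assms] .
  define A :: "real^'m^'m" where "A = (\<chi> i. u (to_nat_on UNIV i))"
  define x :: "real^'m" where "x = (\<chi> i. \<alpha> (to_nat_on UNIV i))"
  have s: "(\<Sum>i\<in>UNIV. x $ i *s row i A) = (\<Sum>i<CARD('m). \<alpha> i *\<^sub>R u i)"
    by (subst sum.reindex_bij_betw[OF bij_index[where 'm='m], symmetric])
      (simp add: x_def A_def row_def scalar_mult_eq_scaleR)
  have "(\<chi> i. (u(j := \<Sum>i<CARD('m). \<alpha> i *\<^sub>R u i)) (to_nat_on UNIV i)) =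
      (\<chi> i. if i = k then (\<Sum>i\<in>UNIV. x $ i *s row i A) else row i A)"
    unfolding s using k index_eq_iff[where 'm='m] by (auto simp: vec_eq_iff A_def row_def)
  then show ?thesis
    unfolding rowdet_def using cramer_lemma_transpose[of k x A]
    by (simp add: x_def A_def k)
qed

lemma rowdet_upd_scaleR:
  fixes u :: "nat \<Rightarrow> real^'m::finite"
  assumes "j < CARD('m)"
  shows "rowdet (u(j := t *\<^sub>R u j)) = t * rowdet u"
proof -
  have "(\<Sum>i<CARD('m). (if i = j then t else 0) *\<^sub>R u i) = t *\<^sub>R u j"
    using assms by (subst sum.remove[of _ j]) auto
  with rowdet_upd_sum[OF assms, of u "\<lambda>i. if i = j then t else 0"] show ?thesis
    by simp
qed

lemma rowdet_scaleR:
  fixes u :: "nat \<Rightarrow> real^'m::finite"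
  shows "rowdet (\<lambda>k. t k *\<^sub>R u k) = (\<Prod>k<CARD('m). t k) * rowdet u"
  unfolding rowdet_def scalar_mult_eq_scaleR[symmetric] det_rows_mul
  by (subst prod.reindex_bij_betw[OF bij_index[where 'm='m]]) simp

lemma rowdet_transpose:
  fixes u :: "nat \<Rightarrow> real^'m::finite"
  assumes "p < CARD('m)" "q < CARD('m)" "p \<noteq> q"
  shows "rowdet (u \<circ> Transposition.transpose p q) = - rowdet u"
proof -
  obtain P Q :: 'm where P: "to_nat_on UNIV P = p" and Q: "to_nat_on UNIV Q = q"
    using index_surj assms by metis
  have "u (Transposition.transpose p q (to_nat_on UNIV i)) = u (to_nat_on UNIV (Transposition.transpose P Q i))" for i :: 'm
    using P Q index_eq_iff[where 'm='m] by (auto simp: Transposition.transpose_def)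
  then have "(\<chi> i. (u \<circ> Transposition.transpose p q) (to_nat_on UNIV i)) =
      (\<chi> i. (\<chi> i. u (to_nat_on UNIV i)) $ (Transposition.transpose P Q i))"
    by (simp add: vec_eq_iff)
  moreover have "P \<noteq> Q"
    using assms P Q by auto
  ultimately show ?thesis
    unfolding rowdet_def
    using det_permute_rows[OF permutes_swap_id[of P UNIV Q], of "\<chi> i. u (to_nat_on UNIV i)"]
    by (simp add: sign_swap_id)
qed

lemma rowdet_matrix_vector_mult:
  fixes u :: "nat \<Rightarrow> real^'m::finite"
  shows "rowdet (\<lambda>k. s *v u k) = det s * rowdet u"
proof -
  have "(\<chi> i. s *v u (to_nat_on UNIV i)) =
      (\<chi> i. u (to_nat_on UNIV i)) ** Finite_Cartesian_Product.transpose s"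
    by (simp add: vec_eq_iff matrix_matrix_mult_def matrix_vector_mult_def
        Finite_Cartesian_Product.transpose_def mult.commute)
  then show ?thesis
    unfolding rowdet_def by (metis det_mul det_transpose mult.commute)
qed

section \<open>Bases and change of basis\<close>

lemma matrix_inv_mult:
  assumes "invertible A"
  shows "A ** matrix_inv A = mat 1" "matrix_inv A ** A = mat 1"
  using someI_ex[OF assms[unfolded invertible_def]] by (auto simp: matrix_inv_def)

lemma rowdet_basis:
  fixes u :: "nat \<Rightarrow> real^'m::finite"
  assumes "rowdet u \<noteq> 0"
  obtains \<alpha> where "w = (\<Sum>i<CARD('m). \<alpha> i *\<^sub>R u i)"
proof -
  define A :: "real^'m^'m" where "A = (\<chi> i. u (to_nat_on UNIV i))"
  have "invertible A"
    using assms by (simp add: invertible_det_nz A_def rowdet_def)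
  then obtain y where y: "y v* A = w"
    by (metis invertible_def matrix_inv_mult(2) vector_matrix_mul_assoc vector_matrix_mul_rid)
  have "w = (\<Sum>i\<in>UNIV. y $ i *\<^sub>R u (to_nat_on UNIV i))"
    unfolding y[symmetric] by (simp add: vec_eq_iff vector_matrix_mult_def A_def mult.commute)
  \<comment> \<open>The coefficient is rewritten as a function of the number of \<open>i\<close>, so
    that the sum can be reindexed along the enumeration.\<close>
  also have "\<dots> = (\<Sum>i\<in>(UNIV :: 'm set). y $ (inv (to_nat_on (UNIV :: 'm set)) (to_nat_on UNIV i)) *\<^sub>R u (to_nat_on UNIV i))"
    using bij_index[where 'm='m] by (simp add: bij_betw_def)
  also have "\<dots> = (\<Sum>i<CARD('m). y $ (inv (to_nat_on (UNIV :: 'm set)) i) *\<^sub>R u i)"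
    by (rule sum.reindex_bij_betw[OF bij_index[where 'm='m]])
  finally show ?thesis
    by (rule that)
qed

lemma rowdet_matrix_exists:
  fixes u v :: "nat \<Rightarrow> real^'m::finite"
  assumes "rowdet u \<noteq> 0"
  obtains s where "\<And>i. i < CARD('m) \<Longrightarrow> s *v u i = v i" and "det s * rowdet u = rowdet v"
proof -
  define A :: "real^'m^'m" where "A = (\<chi> i. u (to_nat_on UNIV i))"
  define B :: "real^'m^'m" where "B = (\<chi> i. v (to_nat_on UNIV i))"
  \<comment> \<open>The vectors are rows while \<open>s\<close> acts on columns, so the requirement
    on \<open>s\<close> reads: \<open>A\<close> times the transpose of \<open>s\<close> equals
    \<open>B\<close>.\<close>
  define s where "s = Finite_Cartesian_Product.transpose (matrix_inv A ** B)"
  have inv: "A ** matrix_inv A = mat 1"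
    using assms by (simp add: matrix_inv_mult invertible_det_nz A_def rowdet_def)
  have "A ** (matrix_inv A ** B) = B"
    by (simp add: matrix_mul_assoc inv)
  then have "A ** Finite_Cartesian_Product.transpose s = B"
    by (simp add: s_def)
  moreover have "A ** Finite_Cartesian_Product.transpose s = (\<chi> i. s *v u (to_nat_on UNIV i))"
    by (simp add: vec_eq_iff matrix_matrix_mult_def matrix_vector_mult_def A_def
        Finite_Cartesian_Product.transpose_def mult.commute)
  ultimately have *: "s *v u (to_nat_on UNIV i) = v (to_nat_on UNIV i)" for i :: 'm
    by (simp add: B_def vec_eq_iff)
  have **: "s *v u i = v i" if "i < CARD('m)" for i
    using index_surj[OF that] * by metis
  then have "det s * rowdet u = rowdet v"
    unfolding rowdet_matrix_vector_mult[symmetric] by (rule rowdet_cong)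
  with ** show ?thesis
    by (rule that)
qed

text \<open>Omitting entry \<open>j\<close> of a tuple amounts to overwriting it by the last entry
  and rearranging by this cycle, so the sign of the cycle enters the determinants of a face.\<close>

definition up_cycle :: "nat \<Rightarrow> nat \<Rightarrow> nat \<Rightarrow> nat" where
  "up_cycle n j k = (if k < j \<or> n \<le> k then k else if Suc k = n then j else Suc k)"

lemma bij_up_cycle:
  assumes "j < n"
  shows "bij_betw (up_cycle n j) {..<n} {..<n}"
proof -
  have "inj_on (up_cycle n j) {..<n}"
    by (auto simp: inj_on_def up_cycle_def split: if_splits)
  moreover have "up_cycle n j ` {..<n} \<subseteq> {..<n}"
    using assms by (auto simp: up_cycle_def)
  ultimately show ?thesis
    by (simp add: bij_betw_def endo_inj_surj)
qed

lemma rowdet_up_cycle: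
  fixes u :: "nat \<Rightarrow> real^'m::finite"
  assumes "j < CARD('m)"
  shows "rowdet (u \<circ> up_cycle CARD('m) j) = (- 1) ^ (CARD('m) - 1 - j) * rowdet u"
proof -
  have "\<forall>u :: nat \<Rightarrow> real^'m. rowdet (u \<circ> up_cycle CARD('m) j) = (- 1) ^ (CARD('m) - 1 - j) * rowdet u"
    if "j \<le> CARD('m) - 1" for j
    using that
  proof (induction j rule: inc_induct)
    case base
    show ?case
    proof
      fix u :: "nat \<Rightarrow> real^'m"
      have "up_cycle CARD('m) (CARD('m) - 1) k = k" for k
        by (auto simp: up_cycle_def)
      then have "u \<circ> up_cycle CARD('m) (CARD('m) - 1) = u"
        by (simp add: fun_eq_iff)
      then show "rowdet (u \<circ> up_cycle CARD('m) (CARD('m) - 1)) =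
          (- 1) ^ (CARD('m) - 1 - (CARD('m) - 1)) * rowdet u"
        by simp
    qed
  next
    case (step j)
    \<comment> \<open>The cycle starting at \<open>j\<close> is the cycle starting at
      \<open>Suc j\<close> followed by one adjacent transposition.\<close>
    have "u \<circ> up_cycle CARD('m) j = (u \<circ> Transposition.transpose j (Suc j)) \<circ> up_cycle CARD('m) (Suc j)"
      for u :: "nat \<Rightarrow> real^'m"
      using step(2) by (auto simp: fun_eq_iff up_cycle_def Transposition.transpose_def)
    moreover have "CARD('m) - 1 - j = Suc (CARD('m) - 1 - Suc j)"
      using step by auto
    ultimately show ?case
      using step by (simp del: o_apply add: rowdet_transpose fun.map_comp o_def[symmetric])
  qed
  with assms show ?thesis
    by simp
qed

section \<open>The orientation cocycle\<close>

lemma sgn_prod: "sgn (\<Prod>i\<in>I. f i) = (\<Prod>i\<in>I. sgn (f i :: real))"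
  by (induction I rule: infinite_finite_induct) (simp_all add: sgn_mult)

text \<open>The exponent is the rank of \<open>t\<close> in \<open>T\<close>, and negative elements
  have the lowest ranks, so the summands alternate apart from one change of sign. Inserting a new
  maximum leaves the other ranks unchanged, which makes the induction work.\<close>

lemma sum_alternating_sgn:
  fixes T :: "real set"
  assumes "finite T" "0 \<notin> T"
  shows "(\<Sum>t\<in>T. (- 1) ^ card {s \<in> T. s < t} * sgn t) =
    (\<Prod>t\<in>T. sgn t) - 1 + (if odd (card T) then 1 else 0)"
  using assms
proof (induction T rule: finite_linorder_max_induct)
  case empty
  then show ?case by simp
next
  case (insert b T)
  have b: "b \<notin> T"
    using insert by auto
  have "{s \<in> insert b T. s < t} = {s \<in> T. s < t}" if "t \<in> T" for t
    using insert that by force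
  moreover have "{s \<in> insert b T. s < b} = T"
    using insert by auto
  ultimately have "(\<Sum>t\<in>insert b T. (- 1) ^ card {s \<in> insert b T. s < t} * sgn t) =
      (- 1) ^ card T * sgn b + (\<Sum>t\<in>T. (- 1) ^ card {s \<in> T. s < t} * sgn t)"
    using insert b by simp
  also have "\<dots> = (- 1) ^ card T * sgn b + ((\<Prod>t\<in>T. sgn t) - 1 + (if odd (card T) then 1 else 0))"
    using insert by simp
  also have "\<dots> = (\<Prod>t\<in>insert b T. sgn t) - 1 + (if odd (card (insert b T)) then 1 else 0)"
  proof (cases "0 < b")
    case True
    then show ?thesis
      using insert b by auto
  next
    \<comment> \<open>A negative maximum forces all elements to be negative, so the product depends
      only on the cardinality.\<close>
    case False
    then have "sgn b = - 1"
      using insert by (auto simp: sgn_if)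
    moreover have "sgn t = - 1" if "t \<in> T" for t
      using insert that False by (auto simp: sgn_if)
    then have "(\<Prod>t\<in>T. sgn t) = (- 1) ^ card T"
      by simp
    ultimately show ?thesis
      using insert b by auto
  qed
  finally show ?case .
qed

text \<open>The inner product is -1 to the power of the rank of \<open>t j\<close>. The cocycle
  relation takes this shape in coordinates, with \<open>t\<close> the ratios of the coordinates of
  the last two vectors.\<close>

lemma sum_prod_sgn_diff:
  fixes t :: "nat \<Rightarrow> real"
  assumes "even n" "inj_on t {..<n}" and nz: "\<And>i. i < n \<Longrightarrow> t i \<noteq> 0"
  shows "(\<Sum>j<n. sgn (t j) * (\<Prod>i\<in>{..<n} - {j}. sgn (t i - t j))) = (\<Prod>i<n. sgn (t i)) - 1"
proof -
  let ?T = "t ` {..<n}"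
  have "(\<Prod>i\<in>{..<n} - {j}. sgn (t i - t j)) = (- 1) ^ card {s \<in> ?T. s < t j}" if "j < n" for j
  proof -
    have "(\<Prod>i\<in>{..<n} - {j}. sgn (t i - t j)) = (\<Prod>i\<in>{..<n} - {j}. if t i < t j then - 1 else 1)"
      using that assms(2) by (intro prod.cong) (auto simp: sgn_if inj_on_def)
    also have "\<dots> = (- 1) ^ card {i \<in> {..<n} - {j}. t i < t j}"
      by (simp add: prod.If_cases Collect_conj_eq[symmetric] Int_def)
    also have "{s \<in> ?T. s < t j} = t ` {i \<in> {..<n} - {j}. t i < t j}"
      by auto
    then have "card {i \<in> {..<n} - {j}. t i < t j} = card {s \<in> ?T. s < t j}"
      using assms(2) by (simp add: card_image inj_on_def)
    finally show ?thesis .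
  qed
  then have "(\<Sum>j<n. sgn (t j) * (\<Prod>i\<in>{..<n} - {j}. sgn (t i - t j))) =
      (\<Sum>j<n. (- 1) ^ card {s \<in> ?T. s < t j} * sgn (t j))"
    by (simp add: mult.commute)
  also have "\<dots> = (\<Sum>s\<in>?T. (- 1) ^ card {r \<in> ?T. r < s} * sgn s)"
    using assms(2) by (simp add: sum.reindex)
  also have "\<dots> = (\<Prod>s\<in>?T. sgn s) - 1"
    using assms nz by (subst sum_alternating_sgn) (auto simp: card_image)
  finally show ?thesis
    using assms(2) by (simp add: prod.reindex)
qed

text \<open>
  A relation \<open>\<Sum>i\<le>m. c\<^sub>i u\<^sub>i = 0\<close> between vectors of \<open>\<real>\<^sup>m\<close> in general position is unique up to a
  scalar. Choosing the signs of the \<open>u\<^sub>i\<close> so that all \<open>c\<^sub>i\<close> have the same sign orients the tuple,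
  because \<open>m\<close> is even; up to a constant, the product below is this orientation.
\<close>

definition orient :: "(nat \<Rightarrow> real^'m::finite) \<Rightarrow> real" where
  "orient u = (\<Prod>i\<le>CARD('m). sgn (rowdet (u(i := u CARD('m)))))"

lemma orient_eq:
  fixes u :: "nat \<Rightarrow> real^'m::finite"
  shows "orient u = sgn (rowdet u) * (\<Prod>i<CARD('m). sgn (rowdet (u(i := u CARD('m)))))"
  by (simp add: orient_def lessThan_Suc_atMost[symmetric])

lemma orient_cong:
  fixes u v :: "nat \<Rightarrow> real^'m::finite"
  assumes "\<And>i. i \<le> CARD('m) \<Longrightarrow> u i = v i"
  shows "orient u = orient v"
  unfolding orient_def
  by (intro prod.cong refl arg_cong[of _ _ sgn] rowdet_cong) (auto simp: assms)

lemma orient_matrix_vector_mult: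
  fixes u :: "nat \<Rightarrow> real^'m::finite"
  assumes "0 < det s"
  shows "orient (\<lambda>k. s *v u k) = orient u"
proof -
  have "(\<lambda>k. s *v u k)(i := s *v u CARD('m)) = (\<lambda>k. s *v (u(i := u CARD('m))) k)" for i
    by auto
  with assms show ?thesis
    by (simp only: orient_def rowdet_matrix_vector_mult sgn_mult sgn_pos mult_1)
qed

text \<open>The \<open>i\<close>-th determinant gains the signs of all \<open>t k\<close> except
  \<open>t i\<close>, that is \<open>T * sgn (t i)\<close>. Over the m + 1 factors this gives
  T^(m+2), a square for even m. Hence \<open>orient\<close> depends only on the lines.\<close>

lemma orient_scaleR:
  fixes u :: "nat \<Rightarrow> real^'m::finite"
  assumes "even CARD('m)" and "\<And>k. k \<le> CARD('m) \<Longrightarrow> t k \<noteq> 0"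
  shows "orient (\<lambda>k. t k *\<^sub>R u k) = orient u"
proof -
  define m where "m = CARD('m)"
  define T where "T = (\<Prod>k\<le>m. sgn (t k))"
  have T: "T * T = 1"
    unfolding T_def prod.distrib[symmetric]
    using assms(2) by (intro prod.neutral) (auto simp: m_def sgn_if)
  have "sgn (rowdet ((\<lambda>k. t k *\<^sub>R u k)(i := t m *\<^sub>R u m))) =
      T * sgn (t i) * sgn (rowdet (u(i := u m)))" if "i \<le> m" for i
  proof -
    have "(\<lambda>k. t k *\<^sub>R u k)(i := t m *\<^sub>R u m) = (\<lambda>k. (t(i := t m)) k *\<^sub>R (u(i := u m)) k)"
      by auto
    then have "sgn (rowdet ((\<lambda>k. t k *\<^sub>R u k)(i := t m *\<^sub>R u m))) =
        sgn (\<Prod>k<m. (t(i := t m)) k) * sgn (rowdet (u(i := u m)))"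
      by (simp only: rowdet_scaleR m_def sgn_mult)
    moreover have "sgn (\<Prod>k<m. (t(i := t m)) k) * sgn (t i) = T"
    proof (cases "i < m")
      case True
      then have "(\<Prod>k<m. sgn ((t(i := t m)) k)) = sgn (t m) * (\<Prod>k\<in>{..<m} - {i}. sgn (t k))"
        by (subst prod.remove[of _ i]) auto
      moreover have "T = sgn (t m) * (sgn (t i) * (\<Prod>k\<in>{..<m} - {i}. sgn (t k)))"
        unfolding T_def lessThan_Suc_atMost[symmetric]
        using True by (subst prod.remove[of _ i, symmetric]) auto
      ultimately show ?thesis
        by (simp add: sgn_prod)
    next
      case False
      then show ?thesis
        using that by (simp add: T_def lessThan_Suc_atMost[symmetric] sgn_prod)
    qed
    moreover have "sgn (t i) * sgn (t i) = 1"
      using assms that by (simp add: m_def sgn_if)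
    ultimately show ?thesis
      by (metis mult.assoc mult.commute mult_1)
  qed
  then have "orient (\<lambda>k. t k *\<^sub>R u k) = (\<Prod>i\<le>m. T * sgn (t i) * sgn (rowdet (u(i := u m))))"
    by (simp add: orient_def m_def)
  also have "\<dots> = T ^ Suc m * T * orient u"
    by (simp add: prod.distrib T_def orient_def m_def)
  also have "T ^ Suc m * T = (T * T) ^ (m div 2) * (T * T)"
    using assms(1) by (simp add: m_def power_mult[symmetric] flip: power2_eq_square)
  finally show ?thesis
    using T by simp
qed

text \<open>The m + 1 determinants are permuted among themselves and each changes its sign; m + 1 is
  odd.\<close>

lemma orient_transpose:
  fixes u :: "nat \<Rightarrow> real^'m::finite"
  assumes "even CARD('m)" and pq: "p < CARD('m)" "q < CARD('m)" "p \<noteq> q"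
  shows "orient (u \<circ> Transposition.transpose p q) = - orient u"
proof -
  let ?m = "CARD('m)" and ?\<tau> = "Transposition.transpose p q"
  have "rowdet ((u \<circ> ?\<tau>)(i := u ?m)) = - rowdet (u(?\<tau> i := u ?m))" for i
  proof -
    have "(u \<circ> ?\<tau>)(i := u ?m) = u(?\<tau> i := u ?m) \<circ> ?\<tau>"
      by (auto simp: fun_eq_iff Transposition.transpose_def)
    then show ?thesis
      using pq by (simp add: rowdet_transpose)
  qed
  moreover have "?\<tau> ?m = ?m"
    using pq by (simp add: Transposition.transpose_def)
  ultimately have "orient (u \<circ> ?\<tau>) =
      - sgn (rowdet u) * (\<Prod>i<?m. - sgn (rowdet (u(?\<tau> i := u ?m))))"
    unfolding orient_eq rowdet_transpose[OF pq] by (simp add: sgn_minus o_def)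
  also have "(\<Prod>i<?m. - sgn (rowdet (u(?\<tau> i := u ?m)))) = (\<Prod>i<?m. - sgn (rowdet (u(i := u ?m))))"
    using pq by (intro prod.reindex_bij_betw[of ?\<tau>] permutes_imp_bij permutes_swap_id) auto
  also have "\<dots> = (\<Prod>i<?m. sgn (rowdet (u(i := u ?m))))"
    using assms(1) by (simp add: prod_uminus)
  finally show ?thesis
    unfolding orient_eq[of u] mult_minus_left .
qed

text \<open>The increasing map that misses \<open>j\<close> (a simplicial coface map), so that
  taking a face is a composition.\<close>

definition skip :: "nat \<Rightarrow> nat \<Rightarrow> nat" where
  "skip j k = (if k < j then k else Suc k)"

text \<open>The first m vectors serve as a basis, in which the last two have coordinates
  \<open>\<alpha>\<close> and \<open>\<beta>\<close>. With
  \<open>t i = \<beta> i / \<alpha> i\<close>, every face becomes a product of signs of the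
  \<open>\<alpha> i\<close>, the \<open>t i\<close> and their differences, and the relation reduces
  to \<open>sum_prod_sgn_diff\<close>.\<close>

lemma orient_cocycle:
  fixes u :: "nat \<Rightarrow> real^'m::finite"
  assumes even: "even CARD('m)"
    and gen: "\<And>g. inj_on g {..<CARD('m)} \<Longrightarrow> g ` {..<CARD('m)} \<subseteq> {..Suc CARD('m)} \<Longrightarrow>
      rowdet (u \<circ> g) \<noteq> 0"
  shows "(\<Sum>j\<le>Suc CARD('m). (- 1) ^ j * orient (u \<circ> skip j)) = 0"
proof -
  define m where "m = CARD('m)"
  define a b where "a = u m" and "b = u (Suc m)"
  define E where "E = rowdet u"
  have E: "E \<noteq> 0"
    using gen[of id] by (force simp: E_def)
  obtain \<alpha> where \<alpha>: "a = (\<Sum>i<m. \<alpha> i *\<^sub>R u i)"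
    using rowdet_basis[of u a] E by (auto simp: E_def m_def)
  obtain \<beta> where \<beta>: "b = (\<Sum>i<m. \<beta> i *\<^sub>R u i)"
    using rowdet_basis[of u b] E by (auto simp: E_def m_def)
  have Ea: "rowdet (u(j := a)) = \<alpha> j * E" if "j < m" for j
    using that rowdet_upd_sum[of j u \<alpha>] by (simp add: \<alpha> E_def m_def)
  have Eb: "rowdet (u(j := b)) = \<beta> j * E" if "j < m" for j
    using that rowdet_upd_sum[of j u \<beta>] by (simp add: \<beta> E_def m_def)
  have \<alpha>0: "\<alpha> j \<noteq> 0" if "j < m" for j
  proof -
    have "inj_on (id(j := m)) {..<m}" "(id(j := m)) ` {..<m} \<subseteq> {..Suc m}"
      using that by (auto simp: inj_on_def)
    then have "rowdet (u \<circ> id(j := m)) \<noteq> 0"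
      using gen by (simp add: m_def)
    moreover have "u \<circ> id(j := m) = u(j := a)"
      by (auto simp: a_def)
    ultimately show ?thesis
      using Ea[OF that] by auto
  qed
  have \<beta>0: "\<beta> j \<noteq> 0" if "j < m" for j
  proof -
    have "inj_on (id(j := Suc m)) {..<m}" "(id(j := Suc m)) ` {..<m} \<subseteq> {..Suc m}"
      using that by (auto simp: inj_on_def)
    then have "rowdet (u \<circ> id(j := Suc m)) \<noteq> 0"
      using gen by (simp add: m_def)
    moreover have "u \<circ> id(j := Suc m) = u(j := b)"
      by (auto simp: b_def)
    ultimately show ?thesis
      using Eb[OF that] by auto
  qed
  define t where "t i = \<beta> i / \<alpha> i" for i
  have Eab: "rowdet (u(j := a, i := b)) = \<alpha> i * \<alpha> j * (t i - t j) * E"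
    if "i < m" "j < m" "i \<noteq> j" for i j
  proof -
    define v where "v = u(j := a)"
    \<comment> \<open>These are the coordinates of \<open>b\<close> after \<open>a\<close> has
      replaced \<open>u j\<close>: subtracting \<open>t j\<close> times \<open>a\<close> from
      \<open>b\<close> removes its component along \<open>u j\<close>.\<close>
    define \<gamma> where "\<gamma> k = (if k = j then t j else \<beta> k - t j * \<alpha> k)" for k
    have "(\<Sum>k<m. \<gamma> k *\<^sub>R v k) = t j *\<^sub>R a + (\<Sum>k\<in>{..<m} - {j}. (\<beta> k - t j * \<alpha> k) *\<^sub>R u k)"
      using that by (subst sum.remove[of _ j]) (auto simp: \<gamma>_def v_def)
    also have "(\<Sum>k\<in>{..<m} - {j}. (\<beta> k - t j * \<alpha> k) *\<^sub>R u k) =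
        (\<Sum>k<m. (\<beta> k - t j * \<alpha> k) *\<^sub>R u k)"
      using that \<alpha>0 by (intro sum.mono_neutral_left) (auto simp: t_def)
    also have "\<dots> = b - t j *\<^sub>R a"
      by (simp add: \<alpha> \<beta> algebra_simps sum_subtractf scaleR_sum_right)
    finally have "b = (\<Sum>k<m. \<gamma> k *\<^sub>R v k)"
      by simp
    then have "rowdet (v(i := b)) = \<gamma> i * rowdet v"
      using that rowdet_upd_sum[of i v \<gamma>] by (simp add: m_def)
    moreover have "\<gamma> i = \<alpha> i * (t i - t j)"
      using that \<alpha>0[of i] by (simp add: \<gamma>_def t_def field_simps)
    ultimately show ?thesis
      using that Ea[of j] by (simp add: v_def)
  qed
  have t_inj: "inj_on t {..<m}"
  proof (rule inj_onI, rule ccontr)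
    fix i j
    assume *: "i \<in> {..<m}" "j \<in> {..<m}" "t i = t j" "i \<noteq> j"
    let ?g = "id(j := m, i := Suc m)"
    have "inj_on ?g {..<m}" "?g ` {..<m} \<subseteq> {..Suc m}"
      using * by (auto simp: inj_on_def)
    then have "rowdet (u \<circ> ?g) \<noteq> 0"
      using gen by (simp add: m_def)
    moreover have "u \<circ> ?g = u(j := a, i := b)"
      by (auto simp: a_def b_def)
    ultimately show False
      using Eab[of i j] * by auto
  qed
  define A where "A = (\<Prod>i<m. sgn (\<alpha> i))"
  have sgnE: "sgn E ^ m = 1"
    using even E by (auto simp: m_def sgn_if)
  have top: "orient (u \<circ> skip (Suc m)) = sgn E * A"
  proof -
    have "orient (u \<circ> skip (Suc m)) = orient u"
      by (intro orient_cong) (simp add: skip_def m_def)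
    also have "\<dots> = sgn E * (\<Prod>i<m. sgn (\<alpha> i * E))"
      unfolding orient_eq m_def[symmetric] a_def[symmetric] using Ea by (simp add: E_def)
    finally show ?thesis
      using sgnE by (simp add: sgn_mult prod.distrib A_def)
  qed
  have "sgn (\<beta> i) = sgn (\<alpha> i) * sgn (t i)" if "i < m" for i
    using \<alpha>0[OF that] by (simp add: t_def sgn_divide sgn_zero_iff)
  then have B: "(\<Prod>i<m. sgn (\<beta> i)) = A * (\<Prod>i<m. sgn (t i))"
    by (simp add: A_def prod.distrib)
  have second: "orient (u \<circ> skip m) = sgn E * (A * (\<Prod>i<m. sgn (t i)))"
  proof -
    have "orient (u \<circ> skip m) = orient (u(m := b))"
      by (intro orient_cong) (auto simp: skip_def m_def b_def)
    also have "\<dots> = sgn (rowdet (u(m := b))) * (\<Prod>i<m. sgn (rowdet (u(m := b, i := b))))"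
      by (simp add: orient_eq m_def[symmetric])
    also have "rowdet (u(m := b)) = E"
      by (auto simp: E_def m_def intro!: rowdet_cong)
    also have "(\<Prod>i<m. sgn (rowdet (u(m := b, i := b)))) = (\<Prod>i<m. sgn (\<beta> i * E))"
    proof (intro prod.cong refl arg_cong[of _ _ sgn])
      fix i assume "i \<in> {..<m}"
      moreover have "rowdet (u(m := b, i := b)) = rowdet (u(i := b))"
        by (auto simp: m_def intro!: rowdet_cong)
      ultimately show "rowdet (u(m := b, i := b)) = \<beta> i * E"
        using Eb by simp
    qed
    finally show ?thesis
      using sgnE B by (simp add: sgn_mult prod.distrib del: o_apply)
  qed
  \<comment> \<open>Up to the cycle, this face is \<open>u\<close> with entry \<open>j\<close>
    overwritten by \<open>a\<close>. The sign \<open>\<epsilon>\<close> of the cycle occurs in m + 1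
    determinants, so one copy of it survives.\<close>
  have rest: "(- 1) ^ j * orient (u \<circ> skip j) =
      - sgn E * A * (sgn (t j) * (\<Prod>i\<in>{..<m} - {j}. sgn (t i - t j)))" if j: "j < m" for j
  proof -
    define w where "w = u(j := a)"
    define c where "c = up_cycle m j"
    define \<epsilon> :: real where "\<epsilon> = (- 1) ^ (m - 1 - j)"
    have sgn\<epsilon>: "sgn \<epsilon> = \<epsilon>"
      by (cases "even (m - 1 - j)") (simp_all add: \<epsilon>_def)
    have \<epsilon>m: "\<epsilon> ^ m = 1"
      using even by (simp add: \<epsilon>_def m_def power_mult[symmetric])
    have c: "rowdet (v \<circ> c) = \<epsilon> * rowdet v" for v :: "nat \<Rightarrow> real^'m"
      using rowdet_up_cycle[of j v] j by (simp add: c_def \<epsilon>_def m_def)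
    have c_bij: "bij_betw c {..<m} {..<m}"
      unfolding c_def using j by (rule bij_up_cycle)
    have skip: "(u \<circ> skip j) k = (w \<circ> c) k" if "k < m" for k
      using that j by (auto simp: skip_def w_def c_def up_cycle_def a_def)
    have "rowdet (u \<circ> skip j) = \<epsilon> * rowdet w"
      unfolding c[symmetric] using skip by (intro rowdet_cong) (simp add: m_def)
    moreover have "rowdet ((u \<circ> skip j)(i := b)) = \<epsilon> * rowdet (w(c i := b))" if "i < m" for i
    proof -
      have "((u \<circ> skip j)(i := b)) k = (w(c i := b) \<circ> c) k" if "k < m" for k
        using skip[OF that] bij_betw_imp_inj_on[OF c_bij] that \<open>i < m\<close>
        by (auto simp: inj_on_def)
      then show ?thesis
        unfolding c[symmetric] by (intro rowdet_cong) (simp add: m_def)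
    qed
    moreover have "(u \<circ> skip j) m = b"
      using j by (simp add: skip_def b_def)
    ultimately have "orient (u \<circ> skip j) =
        sgn (\<epsilon> * rowdet w) * (\<Prod>i<m. sgn (\<epsilon> * rowdet (w(c i := b))))"
      unfolding orient_eq m_def[symmetric] by simp
    also have "(\<Prod>i<m. sgn (\<epsilon> * rowdet (w(c i := b)))) = (\<Prod>i<m. sgn (\<epsilon> * rowdet (w(i := b))))"
      by (rule prod.reindex_bij_betw[OF c_bij])
    also have "\<dots> = (\<Prod>i<m. sgn (rowdet (w(i := b))))"
      using \<epsilon>m by (simp add: sgn_mult prod.distrib sgn\<epsilon>)
    \<comment> \<open>At index \<open>j\<close> the vector \<open>b\<close> overwrites
      \<open>a\<close> itself, which leaves a coordinate of \<open>b\<close>; at the other indices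
      both vectors are present.\<close>
    also have "\<dots> = sgn (\<beta> j * E) * (\<Prod>i\<in>{..<m} - {j}. sgn (\<alpha> i * \<alpha> j * (t i - t j) * E))"
      using j Eb[OF j] Eab by (subst prod.remove[of _ j]) (auto simp: w_def intro!: prod.cong)
    also have "(\<Prod>i\<in>{..<m} - {j}. sgn (\<alpha> i * \<alpha> j * (t i - t j) * E)) =
        (\<Prod>i\<in>{..<m} - {j}. sgn (\<alpha> i)) * (sgn (\<alpha> j) * sgn E) ^ (m - 1) *
          (\<Prod>i\<in>{..<m} - {j}. sgn (t i - t j))"
      using j by (simp add: sgn_mult prod.distrib power_mult_distrib)
    also have "(sgn (\<alpha> j) * sgn E) ^ (m - 1) = sgn (\<alpha> j) * sgn E"
    proof -
      have "odd (m - 1)"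
        using even j by (simp add: m_def)
      then show ?thesis
        using E \<alpha>0[OF j] by (auto simp: sgn_if)
    qed
    also have "sgn (\<epsilon> * rowdet w) = \<epsilon> * (sgn (\<alpha> j) * sgn E)"
      using Ea[OF j] by (simp add: w_def sgn_mult sgn\<epsilon>)
    also have "sgn (\<beta> j * E) = sgn (\<alpha> j) * sgn (t j) * sgn E"
      using \<alpha>0[OF j] by (simp add: t_def sgn_mult sgn_divide sgn_zero_iff)
    finally have *: "orient (u \<circ> skip j) = \<epsilon> * (sgn (\<alpha> j) * sgn E) * (sgn (\<alpha> j) * sgn (t j) * sgn E *
        ((\<Prod>i\<in>{..<m} - {j}. sgn (\<alpha> i)) * (sgn (\<alpha> j) * sgn E) *
          (\<Prod>i\<in>{..<m} - {j}. sgn (t i - t j))))" .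
    have A: "A = sgn (\<alpha> j) * (\<Prod>i\<in>{..<m} - {j}. sgn (\<alpha> i))"
      unfolding A_def using j by (subst prod.remove[of _ j]) auto
    have "(sgn (\<alpha> j))\<^sup>2 = 1" "(sgn E)\<^sup>2 = 1"
      using E \<alpha>0[OF j] by (auto simp: sgn_if)
    then have "orient (u \<circ> skip j) =
        \<epsilon> * (sgn E * A * (sgn (t j) * (\<Prod>i\<in>{..<m} - {j}. sgn (t i - t j))))"
      unfolding * A by algebra
    \<comment> \<open>The sign of the face and the sign of the cycle combine to (-1)^(m-1), the same
      for all \<open>j\<close>.\<close>
    moreover have "(- 1) ^ j * \<epsilon> = - 1"
    proof -
      have "(- 1) ^ j * \<epsilon> = (- 1) ^ (m - 1)"
        unfolding \<epsilon>_def power_add[symmetric] using j by simp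
      also have "odd (m - 1)"
        using even j by (simp add: m_def)
      then have "(- 1) ^ (m - 1) = (- 1 :: real)"
        by simp
      finally show ?thesis .
    qed
    ultimately show ?thesis
      by (metis mult.assoc mult_minus1 mult_minus_left)
  qed
  have "(\<Sum>j\<le>Suc m. (- 1) ^ j * orient (u \<circ> skip j)) =
      (\<Sum>j<m. (- 1) ^ j * orient (u \<circ> skip j)) + orient (u \<circ> skip m) - orient (u \<circ> skip (Suc m))"
    using even by (simp add: lessThan_Suc_atMost[symmetric] m_def)
  also have "(\<Sum>j<m. (- 1) ^ j * orient (u \<circ> skip j)) =
      - sgn E * A * (\<Sum>j<m. sgn (t j) * (\<Prod>i\<in>{..<m} - {j}. sgn (t i - t j)))"
    using rest by (simp add: sum_distrib_left)
  also have "\<dots> = - sgn E * A * ((\<Prod>i<m. sgn (t i)) - 1)"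
    using even t_inj \<alpha>0 \<beta>0 by (subst sum_prod_sgn_diff) (auto simp: m_def t_def)
  finally show ?thesis
    unfolding top second m_def[symmetric] by (simp add: algebra_simps del: o_apply sum.atMost_Suc)
qed

section \<open>A Borel section of the projection to projective space\<close>

lemma Rep_proj_point: "v \<noteq> 0 \<Longrightarrow> Rep_proj (proj_point v) = span {v}"
  unfolding proj_point_def by (subst Abs_proj_inverse) auto

lemma proj_point_scaleR: "t \<noteq> 0 \<Longrightarrow> proj_point (t *\<^sub>R v) = proj_point v"
  unfolding proj_point_def using span_image_scale[of "{v}" "\<lambda>_. t"] by simp

lemma proj_point_eq:
  assumes "v \<noteq> 0" "w \<noteq> 0" "proj_point v = proj_point w"
  obtains t where "t \<noteq> 0" "v = t *\<^sub>R w"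
proof -
  have "v \<in> span {w}"
    using assms Rep_proj_point by (metis singletonI span_base)
  then obtain t where "v = t *\<^sub>R w"
    by (auto simp: span_singleton)
  with assms(1) show ?thesis
    by (intro that[of t]) auto
qed

lemma proj_point_cases:
  obtains v where "v \<noteq> 0" "L = proj_point v"
proof -
  have L: "subspace (Rep_proj L)" "dim (Rep_proj L) = 1"
    using Rep_proj[of L] by auto
  then obtain v where v: "v \<in> Rep_proj L" "v \<noteq> 0"
    by (metis dim_eq_0 insertI1 subsetI zero_neq_one)
  then have "span {v} = Rep_proj L"
    using L by (metis dim_eq_span dim_singleton empty_subsetI insert_subset le_numeral_extra(4) span_eq_iff)
  then have "L = proj_point v"
    by (simp add: proj_point_def Rep_proj_inverse)
  with v show ?thesis
    using that by blast
qed

lemma proj_act_proj_point: "v \<noteq> 0 \<Longrightarrow> proj_act s (proj_point v) = proj_point (s *v v)"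
  unfolding proj_act_def Rep_proj_point proj_point_def[of "s *v v"]
  by (simp add: linear_span_image[OF matrix_vector_mul_linear, symmetric])

text \<open>On the hyperplane at infinity \<open>v $ i = 0\<close> this is the junk value \<open>0\<close>.\<close>

definition affine_chart :: "'m \<Rightarrow> 'm::finite proj \<Rightarrow> real^'m" where
  "affine_chart i L = (let v = SOME v. v \<noteq> 0 \<and> L = proj_point v in (1 / v $ i) *\<^sub>R v)"

lemma affine_chart_proj_point:
  assumes "v \<noteq> 0"
  shows "affine_chart i (proj_point v) = (1 / v $ i) *\<^sub>R v"
proof -
  define w where "w = (SOME w. w \<noteq> 0 \<and> proj_point v = proj_point w)"
  have "w \<noteq> 0 \<and> proj_point v = proj_point w"
    unfolding w_def by (rule someI[of _ v]) (use assms in simp)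
  then obtain t where "t \<noteq> 0" "v = t *\<^sub>R w"
    using assms proj_point_eq by metis
  moreover have "affine_chart i (proj_point v) = (1 / w $ i) *\<^sub>R w"
    by (simp add: affine_chart_def w_def Let_def)
  ultimately show ?thesis
    by simp
qed

text \<open>The chart is continuous on the open set where it is nonzero and constant off it, hence
  Borel although not continuous.\<close>

lemma measurable_affine_chart:
  fixes i :: "'m::finite"
  shows "affine_chart i \<in> borel_measurable borel"
proof (rule borel_measurableI)
  fix U :: "(real^'m) set"
  assume U: "open U"
  define A :: "'m proj set" where "A = {L. affine_chart i L \<noteq> 0}"
  have vec: "{v :: real^'m. v $ i \<noteq> 0 \<and> (1 / v $ i) *\<^sub>R v \<in> W} \<in> {S. open S}" if "open W" for W
  proof -
    have o: "open {v :: real^'m. v $ i \<noteq> 0}"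
      by (intro open_Collect_neq continuous_intros)
    have "continuous_on {v :: real^'m. v $ i \<noteq> 0} (\<lambda>v. (1 / v $ i) *\<^sub>R v)"
      by (intro continuous_intros) auto
    from continuous_open_preimage[OF this o that] show ?thesis
      by (simp add: vimage_def Int_def)
  qed
  have A_open: "open (A \<inter> {L. affine_chart i L \<in> W})" if "open W" for W
  proof -
    have "{v :: real^'m. v \<noteq> 0 \<and> proj_point v \<in> A \<inter> {L. affine_chart i L \<in> W}} =
        {v. v $ i \<noteq> 0 \<and> (1 / v $ i) *\<^sub>R v \<in> W}"
    proof -
      have "v \<noteq> 0" if "v $ i \<noteq> 0" for v :: "real^'m"
        using that by auto
      then show ?thesis
        by (auto simp: A_def affine_chart_proj_point)
    qed
    then show ?thesis
      using vec[OF that] by (simp add: open_proj_def)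
  qed
  have "affine_chart i -` U \<inter> space borel =
      (A \<inter> {L. affine_chart i L \<in> U}) \<union> (if 0 \<in> U then - A else {})"
    by (auto simp: A_def)
  moreover have "A \<in> sets borel"
    using A_open[of UNIV] by simp
  moreover have "A \<inter> {L. affine_chart i L \<in> U} \<in> sets borel"
    using A_open[OF U] by (rule borel_open)
  ultimately show "affine_chart i -` U \<inter> space borel \<in> sets borel"
    by (auto intro!: sets.Un borel_comp)
qed

text \<open>A Borel choice of representatives, normalized at the first nonvanishing coordinate. A
  continuous one would trivialize the tautological line bundle, which is impossible in dimension at
  least 2.\<close>

definition proj_section :: "'m::finite proj \<Rightarrow> real^'m" where
  "proj_section L =
     affine_chart (from_nat_into UNIV (LEAST k. affine_chart (from_nat_into UNIV k) L \<noteq> 0)) L"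

lemma proj_section_proj_point:
  assumes "v \<noteq> 0"
  obtains t where "t \<noteq> 0" "proj_section (proj_point v) = t *\<^sub>R v"
proof -
  from assms obtain i where "v $ i \<noteq> 0"
    by (auto simp: vec_eq_iff)
  then have "affine_chart (from_nat_into UNIV (to_nat_on UNIV i)) (proj_point v) \<noteq> 0"
    using assms by (simp add: affine_chart_proj_point countable_finite)
  then have "proj_section (proj_point v) \<noteq> 0"
    unfolding proj_section_def by (rule LeastI)
  moreover obtain j where "proj_section (proj_point v) = (1 / v $ j) *\<^sub>R v"
    unfolding proj_section_def affine_chart_proj_point[OF assms] by blast
  ultimately show ?thesis
    using that[of "1 / v $ j"] by auto
qed

lemma proj_section_nonzero: "proj_section L \<noteq> 0"
  by (rule proj_point_cases[of L]) (metis proj_section_proj_point scaleR_eq_0_iff)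

lemma proj_point_section: "proj_point (proj_section L) = L"
  by (rule proj_point_cases[of L]) (metis proj_section_proj_point proj_point_scaleR)

lemma measurable_proj_section [measurable]:
  "(proj_section :: 'm::finite proj \<Rightarrow> _) \<in> borel_measurable borel"
  unfolding proj_section_def
proof (rule measurable_compose_countable[where f = "\<lambda>k. affine_chart (from_nat_into UNIV k)"])
  note measurable_affine_chart[measurable]
  show "affine_chart (from_nat_into UNIV k :: 'm) \<in> borel_measurable borel" for k
    by (rule measurable_affine_chart)
  show "(\<lambda>L. LEAST k. affine_chart (from_nat_into UNIV k :: 'm) L \<noteq> 0)
      \<in> borel \<rightarrow>\<^sub>M count_space UNIV"
    by measurable
qed

section \<open>Genericity of almost every tuple\<close>

lemma sets_proj_measure [simp, measurable_cong]: "sets proj_measure = sets borel"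
  by (simp add: proj_measure_def)

lemma space_proj_measure [simp]: "space proj_measure = UNIV"
  by (simp add: proj_measure_def)

lemma emeasure_proj_measure_space:
  "emeasure (proj_measure :: 'm::finite proj measure) UNIV = emeasure lborel (ball (0 :: real^'m) 1 - {0})"
proof -
  have "emeasure (proj_measure :: 'm proj measure) UNIV =
      emeasure (restrict_space lborel (ball (0 :: real^'m) 1 - {0})) (ball 0 1 - {0})"
    unfolding proj_measure_def
    by (subst emeasure_distr) (auto simp: measurable_proj_point space_restrict_space)
  then show ?thesis
    by (simp add: emeasure_restrict_space)
qed

lemma finite_measure_proj_measure: "finite_measure (proj_measure :: 'm::finite proj measure)"
proof
  have "emeasure lborel (ball (0 :: real^'m) 1 - {0}) \<le> emeasure lborel (ball (0 :: real^'m) 1)"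
    by (intro emeasure_mono) auto
  also have "\<dots> < \<infinity>"
    by (rule emeasure_lborel_ball_finite)
  finally show "emeasure (proj_measure :: 'm proj measure) (space proj_measure) \<noteq> \<infinity>"
    by (simp add: emeasure_proj_measure_space)
qed

interpretation proj: product_sigma_finite "\<lambda>_ :: nat. proj_measure :: 'm::finite proj measure"
proof
  interpret finite_measure "proj_measure :: 'm proj measure"
    by (rule finite_measure_proj_measure)
  show "\<exists>A::'m proj set set. countable A \<and> A \<subseteq> sets proj_measure \<and> \<Union>A = space proj_measure \<and>
      (\<forall>a\<in>A. emeasure proj_measure a \<noteq> \<infinity>)"
    by (rule sigma_finite_countable)
qed

text \<open>The condition does not change when a representative is rescaled, so its failure pulls
  back to a hyperplane, a Lebesgue null set.\<close>

lemma AE_proj_measure_inner_section: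
  assumes "w \<noteq> 0"
  shows "AE L in proj_measure. w \<bullet> proj_section L \<noteq> 0"
proof -
  have "{v. w \<bullet> v = 0} \<in> null_sets lebesgue"
    using assms negligible_hyperplane[of w 0] by (simp add: negligible_iff_null_sets)
  moreover have "{v. w \<bullet> v = 0} \<in> sets lborel"
    by (simp add: closed_hyperplane)
  ultimately have "{v. w \<bullet> v = 0} \<in> null_sets lborel"
    by (simp add: null_sets_completion_iff)
  then have "AE v in lborel. w \<bullet> v \<noteq> 0"
    by (rule AE_I') auto
  then have "AE v in lborel. v \<in> ball 0 1 - {0} \<longrightarrow> w \<bullet> proj_section (proj_point v) \<noteq> 0"
  proof eventually_elim
    case (elim v)
    then show ?case
      using proj_section_proj_point[of v] by fastforce
  qed
  then show ?thesis
    unfolding proj_measure_def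
    by (subst AE_distr_iff[OF measurable_proj_point]) (simp_all add: AE_restrict_space_iff)
qed

text \<open>Fubini for null sets, which allows genericity to be established one coordinate at a
  time.\<close>

lemma (in product_sigma_finite) AE_PiM_insert:
  assumes I: "finite I" "i \<notin> I"
    and [measurable]: "Measurable.pred (PiM (insert i I) M) P"
    and AE: "AE x in PiM I M. AE y in M i. P (x(i := y))"
  shows "AE x in PiM (insert i I) M. P x"
proof -
  let ?N = "{x \<in> space (PiM (insert i I) M). \<not> P x}"
  have "emeasure (PiM (insert i I) M) ?N = (\<integral>\<^sup>+x. indicator ?N x \<partial>PiM (insert i I) M)"
    by (simp add: nn_integral_indicator)
  also have "\<dots> = (\<integral>\<^sup>+x. \<integral>\<^sup>+y. indicator ?N (x(i := y)) \<partial>M i \<partial>PiM I M)"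
    by (rule product_nn_integral_insert[OF I]) measurable
  also have "\<dots> = (\<integral>\<^sup>+x. 0 \<partial>PiM I M)"
  proof (rule nn_integral_cong_AE)
    from AE show "AE x in PiM I M. (\<integral>\<^sup>+y. indicator ?N (x(i := y)) \<partial>M i) = 0"
    proof eventually_elim
      case (elim x)
      then have "AE y in M i. indicator ?N (x(i := y)) = (0 :: ennreal)"
        by eventually_elim (simp add: indicator_def)
      then have "(\<integral>\<^sup>+y. indicator ?N (x(i := y)) \<partial>M i) = (\<integral>\<^sup>+y. 0 \<partial>M i)"
        by (rule nn_integral_cong_AE)
      then show ?case
        by simp
    qed
  qed
  finally show ?thesis
    by (intro AE_iff_measurable[THEN iffD2, of ?N]) simp_all
qed

lemma measurable_det:
  fixes f :: "'a \<Rightarrow> 'm::finite \<Rightarrow> real^'m"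
  assumes "\<And>i. (\<lambda>x. f x i) \<in> borel_measurable M"
  shows "(\<lambda>x. det (\<chi> i. f x i)) \<in> borel_measurable M"
proof -
  have [measurable]: "(\<lambda>x. f x i $ j) \<in> borel_measurable M" for i j
    by (rule borel_measurable_continuous_on[OF _ assms]) (intro continuous_intros)
  show ?thesis
    unfolding det_def by simp
qed

text \<open>Interpolation from the identity matrix: standard basis rows are replaced by random ones,
  one at a time. As a function of the new row the determinant is linear, and it is nonzero because
  its value at the old row is the previous determinant.\<close>

lemma AE_generic_det:
  fixes g :: "'m::finite \<Rightarrow> nat"
  assumes "finite I" "inj g" "range g \<subseteq> I"
  shows "AE x in PiM I (\<lambda>_. proj_measure). det (\<chi> i. proj_section (x (g i))) \<noteq> 0"
proof -
  have "AE x in PiM I (\<lambda>_. proj_measure).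
      det (\<chi> i. if i \<in> S then proj_section (x (g i)) else axis i 1) \<noteq> 0" (is "AE x in _. ?d S x \<noteq> 0")
    if "finite S" "g ` S \<subseteq> I" "finite I" for S I
    using that
  proof (induction S arbitrary: I rule: finite_induct)
    case empty
    have "(\<chi> i. axis i 1) = (mat 1 :: real^'m^'m)"
      by (simp add: vec_eq_iff mat_def axis_def)
    then show ?case
      by simp
  next
    case (insert s S)
    define J where "J = I - {g s}"
    have J: "I = insert (g s) J" "g s \<notin> J" "finite J"
      using insert by (auto simp: J_def)
    have gS: "g i \<noteq> g s" if "i \<in> S" for i
      using that insert(2) assms(2) by (auto dest: injD)
    have "AE x in PiM J (\<lambda>_. proj_measure). ?d S x \<noteq> 0"
      using insert.prems gS by (intro insert.IH) (auto simp: J_def)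
    then have AE: "AE x in PiM J (\<lambda>_. proj_measure). AE y in proj_measure. ?d (insert s S) (x(g s := y)) \<noteq> 0"
    proof eventually_elim
      case (elim x)
      define r where "r v = (\<chi> i. if i = s then v else
          if i \<in> S then proj_section (x (g i)) else axis i 1)" for v :: "real^'m"
      have lin: "linear (\<lambda>v. det (r v))"
        unfolding r_def
        by (rule linearI) (simp_all add: det_row_add det_row_mul[where 'a = real, unfolded scalar_mult_eq_scaleR])
      \<comment> \<open>The vector that represents the linear functional, so that the exceptional
        rows form a hyperplane.\<close>
      define w where "w = adjoint (\<lambda>v. det (r v)) 1"
      have w: "det (r v) = w \<bullet> v" for v
        using adjoint_works[OF lin, of v 1] by (simp add: w_def inner_commute)
      have "r (axis s 1) = (\<chi> i. if i \<in> S then proj_section (x (g i)) else axis i 1)"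
        using insert(2) by (simp add: r_def vec_eq_iff)
      then have "w \<noteq> 0"
        using elim w[of "axis s 1"] by auto
      then have "AE y in proj_measure. w \<bullet> proj_section y \<noteq> 0"
        by (rule AE_proj_measure_inner_section)
      moreover have "?d (insert s S) (x(g s := y)) = det (r (proj_section y))" for y
        unfolding r_def using gS by (intro arg_cong[of _ _ det]) (auto simp: vec_eq_iff)
      ultimately show ?case
        by (simp add: w)
    qed
    show ?case
      unfolding J(1)
    proof (rule proj.AE_PiM_insert[OF J(3,2) _ AE])
      have [measurable]: "(\<lambda>x. ?d (insert s S) x) \<in> borel_measurable (PiM (insert (g s) J) (\<lambda>_. proj_measure))"
      proof (rule measurable_det)
        fix i
        show "(\<lambda>x. if i \<in> insert s S then proj_section (x (g i)) else axis i 1)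
            \<in> borel_measurable (PiM (insert (g s) J) (\<lambda>_. proj_measure))"
        proof (cases "i \<in> insert s S")
          case True
          then have "g i \<in> insert (g s) J"
            using insert.prems J(1) by blast
          then show ?thesis
            using True by simp
        qed simp
      qed
      show "Measurable.pred (PiM (insert (g s) J) (\<lambda>_. proj_measure)) (\<lambda>x. ?d (insert s S) x \<noteq> 0)"
        by measurable
    qed
  qed
  from this[of UNIV I] assms show ?thesis
    by auto
qed

lemma AE_generic_tuple:
  "AE x :: nat \<Rightarrow> 'm::finite proj in proj_pow N. \<forall>g. inj_on g {..<CARD('m)} \<longrightarrow>
     g ` {..<CARD('m)} \<subseteq> {..<N} \<longrightarrow> rowdet ((\<lambda>k. proj_section (x k)) \<circ> g) \<noteq> 0"
proof -
  \<comment> \<open>Transported to the index type, the selections of entries become finitely many,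
    so their exceptional null sets can be united.\<close>
  let ?G = "{g :: 'm \<Rightarrow> nat. inj g \<and> range g \<subseteq> {..<N}}"
  have "finite (UNIV \<rightarrow>\<^sub>E {..<N} :: ('m \<Rightarrow> nat) set)"
    by (intro finite_PiE) auto
  then have "finite ?G"
    by (rule rev_finite_subset) auto
  then have "AE x :: nat \<Rightarrow> 'm proj in PiM {..<N} (\<lambda>_. proj_measure).
      \<forall>g\<in>?G. det (\<chi> i. proj_section (x (g i))) \<noteq> 0"
    by (rule AE_finite_allI) (use AE_generic_det[of "{..<N}"] in auto)
  then have "AE x :: nat \<Rightarrow> 'm proj in PiM {..<N} (\<lambda>_. proj_measure).
     \<forall>g. inj_on g {..<CARD('m)} \<longrightarrow>
       g ` {..<CARD('m)} \<subseteq> {..<N} \<longrightarrow> rowdet ((\<lambda>k. proj_section (x k)) \<circ> g) \<noteq> 0"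
  proof eventually_elim
    case (elim x)
    show ?case
    proof (intro allI impI)
      fix g :: "nat \<Rightarrow> nat"
      assume g: "inj_on g {..<CARD('m)}" "g ` {..<CARD('m)} \<subseteq> {..<N}"
      then have "g \<circ> to_nat_on (UNIV :: 'm set) \<in> ?G"
        using bij_index[where 'm='m] by (auto simp: bij_betw_def intro!: comp_inj_on)
      from bspec[OF elim this] show "rowdet ((\<lambda>k. proj_section (x k)) \<circ> g) \<noteq> 0"
        by (simp add: rowdet_def)
    qed
  qed
  then show ?thesis
    unfolding proj_pow_def AE_completion_iff .
qed

text \<open>The measure is nonzero, so a property that holds almost everywhere is attained at an
  actual tuple.\<close>

lemma not_AE_proj_pow_False: "\<not> (AE x :: nat \<Rightarrow> 'm::finite proj in proj_pow N. False)"
proof -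
  have "{0 :: real^'m} \<in> null_sets lborel"
    by (simp add: null_sets_def)
  then have "emeasure lborel (ball (0 :: real^'m) 1 - {0}) = emeasure lborel (ball (0 :: real^'m) 1)"
    by (intro emeasure_Diff_null_set) auto
  also have "\<dots> \<noteq> 0"
  proof -
    have "unit_ball_vol (real CARD('m)) \<noteq> 0"
      by (rule less_imp_neq[OF unit_ball_vol_pos, symmetric]) simp
    then show ?thesis
      by (simp add: emeasure_ball)
  qed
  finally have "emeasure (proj_measure :: 'm proj measure) UNIV \<noteq> 0"
    by (simp add: emeasure_proj_measure_space)
  then have "emeasure (PiM {..<N} (\<lambda>_. proj_measure :: 'm proj measure)) ({..<N} \<rightarrow>\<^sub>E UNIV) \<noteq> 0"
    by (subst proj.emeasure_PiM) auto
  then show ?thesis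
    unfolding proj_pow_def AE_completion_iff by (subst AE_iff_null) (auto simp: null_sets_def space_PiM)
qed

section \<open>The orientation cocycle on projective space\<close>

definition orient_cochain :: "(nat \<Rightarrow> 'm::finite proj) \<Rightarrow> real" where
  "orient_cochain = (\<lambda>x\<in>space (proj_pow (Suc CARD('m))). orient (\<lambda>k. proj_section (x k)))"

lemma orient_cochain_proj_point:
  fixes u :: "nat \<Rightarrow> real^'m::finite"
  assumes "even CARD('m)" and x: "x \<in> space (proj_pow (Suc CARD('m)))"
    and u: "\<And>k. k \<le> CARD('m) \<Longrightarrow> u k \<noteq> 0 \<and> x k = proj_point (u k)"
  shows "orient_cochain x = orient u"
proof -
  have "\<exists>t. t \<noteq> 0 \<and> proj_section (x k) = t *\<^sub>R u k" if "k \<le> CARD('m)" for k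
    using u[OF that] by (metis proj_section_proj_point)
  then obtain t where t: "\<And>k. k \<le> CARD('m) \<Longrightarrow> t k \<noteq> 0 \<and> proj_section (x k) = t k *\<^sub>R u k"
    by metis
  have "orient_cochain x = orient (\<lambda>k. proj_section (x k))"
    using x by (simp add: orient_cochain_def)
  also have "\<dots> = orient (\<lambda>k. t k *\<^sub>R u k)"
    using t by (intro orient_cong) auto
  also have "\<dots> = orient u"
    using t assms(1) by (intro orient_scaleR) auto
  finally show ?thesis .
qed

section \<open>Measurability, boundedness and nonvanishing of the cochain\<close>

lemma abs_orient_le: "\<bar>orient u\<bar> \<le> 1"
  unfolding orient_def abs_prod by (intro prod_le_1) (auto simp: abs_sgn_eq)

lemma bounded_meas_restrict:
  assumes "f \<in> borel_measurable (PiM {..<p} (\<lambda>_. proj_measure))" "\<And>x. \<bar>f x\<bar> \<le> B"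
  shows "(\<lambda>x\<in>space (proj_pow p). f x) \<in> bounded_meas (proj_pow p)"
proof -
  have "f \<in> borel_measurable (proj_pow p)"
    unfolding proj_pow_def using assms(1) by (rule measurable_completion)
  then have "(\<lambda>x\<in>space (proj_pow p). f x) \<in> borel_measurable (proj_pow p)"
    by (rule measurable_cong[THEN iffD2, rotated]) simp
  moreover have "bounded ((\<lambda>x\<in>space (proj_pow p). f x) ` space (proj_pow p))"
    using assms(2) by (intro boundedI[of _ B]) auto
  ultimately show ?thesis
    by (auto simp: bounded_meas_def)
qed

text \<open>The reindexing \<open>h\<close> covers the cochain itself as well as its faces, where
  \<open>h\<close> is \<open>skip j\<close>.\<close>

lemma measurable_orient_section:
  fixes h :: "nat \<Rightarrow> nat"
  assumes "h ` {..CARD('m::finite)} \<subseteq> I"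
  shows "(\<lambda>x. orient (\<lambda>k. proj_section (x (h k)) :: real^'m)) \<in>
    borel_measurable (PiM I (\<lambda>_. proj_measure))"
proof -
  have "(\<lambda>x. rowdet ((\<lambda>k. proj_section (x (h k)) :: real^'m)(i := proj_section (x (h CARD('m)))))) \<in>
      borel_measurable (PiM I (\<lambda>_. proj_measure))" for i
    unfolding rowdet_def
  proof (rule measurable_det)
    fix j :: 'm
    define l where "l = h (if to_nat_on UNIV j = i then CARD('m) else to_nat_on UNIV j)"
    have "l \<in> I"
      using assms index_less[of j] by (auto simp: l_def)
    then have "(\<lambda>x. proj_section (x l) :: real^'m) \<in> borel_measurable (PiM I (\<lambda>_. proj_measure))"
      by simp
    then show "(\<lambda>x. ((\<lambda>k. proj_section (x (h k)) :: real^'m)(i := proj_section (x (h CARD('m)))))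
        (to_nat_on UNIV j)) \<in> borel_measurable (PiM I (\<lambda>_. proj_measure))"
      by (simp add: l_def if_distrib cong: if_cong)
  qed
  then show ?thesis
    unfolding orient_def by simp
qed

lemma orient_cochain_bounded_meas:
  "(orient_cochain :: (nat \<Rightarrow> 'm::finite proj) \<Rightarrow> real) \<in> bounded_meas (proj_pow (Suc CARD('m)))"
  unfolding orient_cochain_def
  by (rule bounded_meas_restrict[OF measurable_orient_section[where h = "\<lambda>k. k"] abs_orient_le])
    (simp add: lessThan_Suc_atMost)

lemma AE_orient_cochain_nonzero:
  "AE x :: nat \<Rightarrow> 'm::finite proj in proj_pow (Suc CARD('m)). orient_cochain x \<noteq> 0"
  using AE_generic_tuple[of "Suc CARD('m)"] AE_space
proof eventually_elim
  case (elim x)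
  let ?u = "\<lambda>k. proj_section (x k)"
  have "rowdet (?u(i := ?u CARD('m))) \<noteq> 0" for i
  proof -
    have "inj_on (id(i := CARD('m))) {..<CARD('m)}"
        "(id(i := CARD('m))) ` {..<CARD('m)} \<subseteq> {..<Suc CARD('m)}"
      by (auto simp: inj_on_def)
    moreover have "?u \<circ> id(i := CARD('m)) = ?u(i := ?u CARD('m))"
      by auto
    ultimately show ?thesis
      using elim(1) by metis
  qed
  then show ?case
    using elim(2) by (simp add: orient_cochain_def orient_def sgn_zero_iff)
qed

section \<open>Invariance, symmetry and the cocycle relation\<close>

lemma matrix_inv_proj_act:
  assumes "det s \<noteq> 0"
  shows "proj_act (matrix_inv s) (proj_act s L) = L"
proof (rule proj_point_cases[of L])
  fix v assume v: "v \<noteq> 0" "L = proj_point v"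
  have inv: "matrix_inv s *v (s *v v) = v"
    using assms by (simp add: matrix_vector_mul_assoc matrix_inv_mult invertible_det_nz)
  then have "s *v v \<noteq> 0"
    using v(1) by auto
  then show ?thesis
    using v by (simp add: proj_act_proj_point inv)
qed

lemma translate_orient_cochain:
  fixes s :: "real^'m^'m::finite"
  assumes "even CARD('m)" "s \<in> GL_pos"
  shows "translate (Suc CARD('m)) s orient_cochain = orient_cochain"
proof
  fix x :: "nat \<Rightarrow> 'm proj"
  have s: "0 < det s"
    using assms by (simp add: GL_pos_def)
  then have inv: "matrix_inv s ** s = mat 1"
    by (intro matrix_inv_mult) (simp add: invertible_det_nz)
  then have "det (matrix_inv s) * det s = 1"
    by (metis det_I det_mul)
  then have det: "0 < det (matrix_inv s)"
    using s by (metis zero_less_mult_pos2 zero_less_one)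
  show "translate (Suc CARD('m)) s orient_cochain x = orient_cochain x"
  proof (cases "x \<in> space (proj_pow (Suc CARD('m)))")
    case True
    have "orient_cochain (diag_act (Suc CARD('m)) (matrix_inv s) x) =
        orient (\<lambda>k. matrix_inv s *v proj_section (x k))"
    proof (rule orient_cochain_proj_point[OF assms(1)])
      show "diag_act (Suc CARD('m)) (matrix_inv s) x \<in> space (proj_pow (Suc CARD('m)))"
        by (auto simp: space_proj_pow diag_act_def)
    next
      fix k assume k: "k \<le> CARD('m)"
      have "invertible (matrix_inv s)"
        using det by (simp add: invertible_det_nz)
      then have "matrix_inv s *v proj_section (x k) \<noteq> 0"
        using proj_section_nonzero[of "x k"]
        by (metis matrix_inv_mult(2) matrix_vector_mul_assoc matrix_vector_mul_lid matrix_vector_mult_0_right)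
      moreover have "diag_act (Suc CARD('m)) (matrix_inv s) x k =
          proj_act (matrix_inv s) (proj_point (proj_section (x k)))"
        using k by (simp add: diag_act_def proj_point_section)
      ultimately show "matrix_inv s *v proj_section (x k) \<noteq> 0 \<and>
          diag_act (Suc CARD('m)) (matrix_inv s) x k = proj_point (matrix_inv s *v proj_section (x k))"
        by (simp add: proj_act_proj_point proj_section_nonzero)
    qed
    also have "\<dots> = orient_cochain x"
      using True by (simp add: orient_matrix_vector_mult[OF det] orient_cochain_def)
    finally show ?thesis
      using True by (simp add: translate_def)
  qed (simp add: translate_def orient_cochain_def)
qed

text \<open>The negative is written as a scalar multiple to match the homogeneity of a linear
  lifting.\<close>

lemma permute_orient_cochain:
  assumes "even CARD('m::finite)" "a < CARD('m)" "b < CARD('m)" "a \<noteq> b"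
  shows "permute_coords (Suc CARD('m)) (Transposition.transpose a b) orient_cochain =
    (\<lambda>x :: nat \<Rightarrow> 'm proj \<in> space (proj_pow (Suc CARD('m))). (- 1) * orient_cochain x)"
proof -
  have "orient_cochain (x \<circ> Transposition.transpose a b) = - orient_cochain x"
    if x: "x \<in> space (proj_pow (Suc CARD('m)))" for x :: "nat \<Rightarrow> 'm proj"
  proof -
    have "x \<circ> Transposition.transpose a b \<in> space (proj_pow (Suc CARD('m)))"
      using x assms by (auto simp: space_proj_pow PiE_iff extensional_def Transposition.transpose_def)
    moreover have "(\<lambda>k. proj_section ((x \<circ> Transposition.transpose a b) k)) =
        (\<lambda>k. proj_section (x k)) \<circ> Transposition.transpose a b"
      by auto
    ultimately show ?thesis
      using x orient_transpose[OF assms, of "\<lambda>k. proj_section (x k)"]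
      by (simp add: orient_cochain_def del: o_apply)
  qed
  then show ?thesis
    by (auto simp: permute_coords_def)
qed

lemma omit_eq: "omit p j x = (\<lambda>i\<in>{..<p}. x (skip j i))"
  by (auto simp: omit_def skip_def)

text \<open>\<open>omit\<close> truncates the tuple and \<open>skip\<close> does not, but
  \<open>orient\<close> reads only the entries up to \<open>CARD('m)\<close>.\<close>

lemma orient_cochain_omit:
  fixes x :: "nat \<Rightarrow> 'm::finite proj"
  shows "orient_cochain (omit (Suc CARD('m)) j x) = orient ((\<lambda>k. proj_section (x k)) \<circ> skip j)"
  unfolding orient_cochain_def omit_eq
  by (auto simp: space_proj_pow intro!: orient_cong)

text \<open>The relation is available only in general position, hence almost everywhere; the
  liftings turn it into one at every tuple.\<close>

lemma coboundary_orient_cochain: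
  "(coboundary (Suc CARD('m)) orient_cochain :: (nat \<Rightarrow> 'm::finite proj) \<Rightarrow> real)
    \<in> bounded_meas (proj_pow (Suc (Suc CARD('m))))"
  "even CARD('m) \<Longrightarrow> AE x :: nat \<Rightarrow> 'm proj in proj_pow (Suc (Suc CARD('m))).
    coboundary (Suc CARD('m)) orient_cochain x = 0"
proof -
  have eq: "coboundary (Suc CARD('m)) orient_cochain =
      (\<lambda>x :: nat \<Rightarrow> 'm proj \<in> space (proj_pow (Suc (Suc CARD('m)))).
        \<Sum>j\<le>Suc CARD('m). (- 1) ^ j * orient ((\<lambda>k. proj_section (x k)) \<circ> skip j))"
    unfolding coboundary_def orient_cochain_omit atLeast0AtMost ..
  show "(coboundary (Suc CARD('m)) orient_cochain :: (nat \<Rightarrow> 'm proj) \<Rightarrow> real)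
    \<in> bounded_meas (proj_pow (Suc (Suc CARD('m))))"
    unfolding eq
  proof (rule bounded_meas_restrict)
    have "(\<lambda>x. orient ((\<lambda>k. proj_section (x k) :: real^'m) \<circ> skip j)) \<in>
        borel_measurable (PiM {..<Suc (Suc CARD('m))} (\<lambda>_. proj_measure))" for j
      unfolding o_def by (rule measurable_orient_section) (auto simp: skip_def)
    then show "(\<lambda>x. \<Sum>j\<le>Suc CARD('m). (- 1) ^ j * orient ((\<lambda>k. proj_section (x k) :: real^'m) \<circ> skip j)) \<in>
        borel_measurable (PiM {..<Suc (Suc CARD('m))} (\<lambda>_. proj_measure))"
      by (intro borel_measurable_sum borel_measurable_times borel_measurable_const)
  next
    fix x :: "nat \<Rightarrow> 'm proj"
    have "\<bar>\<Sum>j\<le>Suc CARD('m). (- 1) ^ j * orient ((\<lambda>k. proj_section (x k)) \<circ> skip j)\<bar> \<le>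
        (\<Sum>j\<le>Suc CARD('m). \<bar>(- 1) ^ j * orient ((\<lambda>k. proj_section (x k)) \<circ> skip j)\<bar>)"
      by (rule sum_abs)
    also have "\<dots> \<le> (\<Sum>j\<le>Suc CARD('m). 1)"
      by (intro sum_mono) (simp add: abs_mult power_abs abs_orient_le del: o_apply)
    finally show "\<bar>\<Sum>j\<le>Suc CARD('m). (- 1) ^ j * orient ((\<lambda>k. proj_section (x k)) \<circ> skip j)\<bar> \<le>
        (\<Sum>j\<le>Suc CARD('m). 1)" .
  qed
  assume even: "even CARD('m)"
  show "AE x :: nat \<Rightarrow> 'm proj in proj_pow (Suc (Suc CARD('m))).
      coboundary (Suc CARD('m)) orient_cochain x = 0"
    using AE_generic_tuple[of "Suc (Suc CARD('m))"] AE_space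
  proof eventually_elim
    case (elim x)
    then have "(\<Sum>j\<le>Suc CARD('m). (- 1) ^ j * orient ((\<lambda>k. proj_section (x k)) \<circ> skip j)) = 0"
      by (intro orient_cocycle[OF even]) (simp add: lessThan_Suc_atMost del: o_apply)
    with elim show ?case
      by (simp add: eq del: o_apply sum.atMost_Suc)
  qed
qed

section \<open>Degenerate tuples\<close>

lemma rowdet_nonzero_vector:
  fixes u :: "nat \<Rightarrow> real^'m::finite"
  assumes "rowdet u \<noteq> 0" "j < CARD('m)"
  shows "u j \<noteq> 0"
proof
  assume "u j = 0"
  then have "u(j := 0 *\<^sub>R u j) = u"
    by auto
  then show False
    using rowdet_upd_scaleR[OF assms(2), of u 0] assms(1) by simp
qed

text \<open>A swap of basis vectors has determinant -1. Flipping a third one restores the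
  orientation and moves none of the basis lines, so projectively only the swap is seen on
  them.\<close>

lemma swap_flip_matrix:
  fixes u :: "nat \<Rightarrow> real^'m::finite"
  assumes u: "rowdet u \<noteq> 0"
    and pqr: "p < CARD('m)" "q < CARD('m)" "r < CARD('m)" "p \<noteq> q" "p \<noteq> r" "q \<noteq> r"
  obtains s where "s \<in> GL_pos" "s *v u p = u q" "s *v u q = u p" "s *v u r = - u r"
    "\<And>i. i < CARD('m) \<Longrightarrow> i \<notin> {p, q, r} \<Longrightarrow> s *v u i = u i"
proof -
  let ?w = "u \<circ> Transposition.transpose p q"
  let ?v = "?w(r := (- 1) *\<^sub>R ?w r)"
  obtain s where s: "\<And>i. i < CARD('m) \<Longrightarrow> s *v u i = ?v i" "det s * rowdet u = rowdet ?v"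
    using rowdet_matrix_exists[OF u] by blast
  have "rowdet ?v = rowdet u"
    unfolding rowdet_upd_scaleR[OF pqr(3)] using pqr by (simp add: rowdet_transpose del: o_apply)
  then have "det s = 1"
    using s u by simp
  then show ?thesis
    using s(1) pqr by (intro that[of s]) (auto simp: GL_pos_def Transposition.transpose_def)
qed

lemma proj_point_uminus: "proj_point (- v) = proj_point v"
  using proj_point_scaleR[of "- 1" v] by simp

lemma alternating_invariant_vanishes:
  fixes f :: "(nat \<Rightarrow> 'm::finite proj) \<Rightarrow> real" and s :: "real^'m^'m"
  assumes inv: "translate p s f = f" and s: "s \<in> GL_pos"
    and alt: "permute_coords p (Transposition.transpose a b) f = (\<lambda>x\<in>space (proj_pow p). - f x)"
    and ab: "a < p" "b < p"
    and z: "z \<in> space (proj_pow p)"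
    and act: "\<And>k. k < p \<Longrightarrow> proj_act s (z k) = z (Transposition.transpose a b k)"
  shows "f z = 0"
proof -
  let ?\<tau> = "Transposition.transpose a b"
  \<comment> \<open>Translation uses the inverse matrix, which induces the same swap because a
    transposition is an involution.\<close>
  have "proj_act (matrix_inv s) (z k) = z (?\<tau> k)" if "k < p" for k
  proof -
    have "proj_act s (z (?\<tau> k)) = z (?\<tau> (?\<tau> k))"
      using ab that by (intro act) (auto simp: Transposition.transpose_def)
    then show ?thesis
      using matrix_inv_proj_act[of s "z (?\<tau> k)"] s by (simp add: GL_pos_def)
  qed
  \<comment> \<open>Equality of extensional tuples also concerns the indices outside the
    range.\<close>
  moreover have "z (?\<tau> k) = undefined" if "\<not> k < p" for k
    using that ab z by (auto simp: Transposition.transpose_def space_proj_pow PiE_iff extensional_def)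
  ultimately have "diag_act p (matrix_inv s) z = z \<circ> ?\<tau>"
    by (auto simp: diag_act_def)
  then have "f (z \<circ> ?\<tau>) = f z"
    using fun_cong[OF inv, of z] z by (simp add: translate_def)
  moreover have "f (z \<circ> ?\<tau>) = - f z"
    using fun_cong[OF alt, of z] z by (simp add: permute_coords_def)
  ultimately show ?thesis
    by simp
qed

text \<open>
  The face without the last vector is in general position, every other one is degenerate,
  so that the cocycle relation cannot hold for a cochain that vanishes on degenerate tuples.
\<close>

definition config :: "(nat \<Rightarrow> real^'m::finite) \<Rightarrow> nat \<Rightarrow> real^'m" where
  "config c k = (if k < CARD('m) then c k else if k = CARD('m) then \<Sum>i<CARD('m). c i else c 0 + c 1)"

lemma rowdet_upd_sum_all:
  fixes c :: "nat \<Rightarrow> real^'m::finite"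
  assumes "j < CARD('m)"
  shows "rowdet (c(j := \<Sum>i<CARD('m). c i)) = rowdet c"
  using rowdet_upd_sum[OF assms, of c "\<lambda>_. 1"] by simp

lemma rowdet_upd_sum_two:
  fixes c :: "nat \<Rightarrow> real^'m::finite"
  assumes "2 \<le> CARD('m)" "j < 2"
  shows "rowdet (c(j := c 0 + c 1)) = rowdet c"
proof -
  have "(\<Sum>i\<in>{0, 1}. c i) = (\<Sum>i<CARD('m). (if i < 2 then 1 else 0 :: real) *\<^sub>R c i)"
    using assms(1) by (intro sum.mono_neutral_cong_left) auto
  then show ?thesis
    using rowdet_upd_sum[of j c "\<lambda>i. if i < 2 then 1 else 0"] assms by simp
qed

text \<open>Each vector occurs in some basis; without this \<open>proj_point\<close> would be
  meaningless on it.\<close>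

lemma config_nonzero:
  fixes c :: "nat \<Rightarrow> real^'m::finite"
  assumes "2 \<le> CARD('m)" "rowdet c \<noteq> 0"
  shows "config c k \<noteq> 0"
  using rowdet_nonzero_vector[OF assms(2), of k]
    rowdet_nonzero_vector[of "c(0 := \<Sum>i<CARD('m). c i)" 0]
    rowdet_nonzero_vector[of "c(0 := c 0 + c 1)" 0]
    rowdet_upd_sum_all[of 0 c] rowdet_upd_sum_two[of 0 c] assms
  by (auto simp: config_def)

text \<open>
  The matrix swaps two vectors of a basis taken from the face which enter the remaining
  point symmetrically, and flips the sign of one which does not enter it.
\<close>

lemma config_face_symmetry:
  fixes c :: "nat \<Rightarrow> real^'m::finite"
  assumes card: "4 \<le> CARD('m)" and c: "rowdet c \<noteq> 0" and j: "j \<le> CARD('m)"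
  obtains s a where "s \<in> GL_pos" "Suc a < CARD('m)"
    "\<And>k. k \<le> CARD('m) \<Longrightarrow> proj_act s (proj_point (config c (skip j k))) =
       proj_point (config c (skip j (Transposition.transpose a (Suc a) k)))"
proof (cases "j < 2")
  case False
  define m where "m = CARD('m)"
  \<comment> \<open>Here \<open>c 0\<close> and \<open>c 1\<close> are swapped, which fixes their
    sum. If some \<open>c j\<close> is omitted, the sum of all vectors takes its place in the basis
    and is flipped; if that sum is omitted, \<open>c 2\<close> is flipped.\<close>
  define d where "d = (if j = m then c else c(j := \<Sum>i<m. c i))"
  define r where "r = (if j = m then 2 else j)"
  have r: "r < m" "2 \<le> r"
    using False j card by (auto simp: r_def m_def)
  have "rowdet d \<noteq> 0"
    using rowdet_upd_sum_all[of j c] c j card by (auto simp: d_def m_def)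
  moreover have "0 < CARD('m)" "1 < CARD('m)" "r < CARD('m)" "0 \<noteq> (1 :: nat)" "0 \<noteq> r" "1 \<noteq> r"
    using r card by (auto simp: m_def)
  ultimately obtain s where s: "s \<in> GL_pos" "s *v d 0 = d 1" "s *v d 1 = d 0" "s *v d r = - d r"
    "\<And>i. i < CARD('m) \<Longrightarrow> i \<notin> {0, 1, r} \<Longrightarrow> s *v d i = d i"
    by (rule swap_flip_matrix) (rule that)
  have d: "d i = c i" if "i \<noteq> j" for i
    using that by (simp add: d_def)
  have low: "s *v c 0 = c 1" "s *v c 1 = c 0"
    using s(2,3) False by (auto simp: d)
  have low_config: "s *v config c 0 = config c (Suc 0)" "s *v config c (Suc 0) = config c 0"
    using low card by (simp_all add: config_def)
  have high: "s *v config c l = config c l \<or> s *v config c l = - config c l" if "l \<noteq> j" "2 \<le> l" for l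
  proof (cases "l < m")
    case True
    then show ?thesis
      using s(4) s(5)[of l] that by (cases "l = r") (auto simp: config_def d m_def)
  next
    case l: False
    show ?thesis
    proof (cases "l = m")
      case True
      then have "j \<noteq> m" "d r = (\<Sum>i<m. c i)"
        using that by (auto simp: d_def r_def)
      then show ?thesis
        using s(4) True by (simp add: config_def m_def)
    next
      case False
      then show ?thesis
        using l low by (simp add: config_def m_def matrix_vector_right_distrib add.commute)
    qed
  qed
  have "proj_act s (proj_point (config c (skip j k))) =
      proj_point (config c (skip j (Transposition.transpose 0 (Suc 0) k)))" for k
  proof -
    have cn: "config c l \<noteq> 0" for l
      using config_nonzero[OF _ c] card by simp
    consider "k = 0" | "k = 1" | "2 \<le> k"
      by linarith
    then show ?thesis
    proof cases
      case 3
      then have "s *v config c (skip j k) = config c (skip j k) \<or>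
          s *v config c (skip j k) = - config c (skip j k)"
        by (intro high) (auto simp: skip_def)
      then show ?thesis
        using 3 cn by (auto simp: proj_act_proj_point proj_point_uminus Transposition.transpose_def)
    qed (use low_config False in \<open>simp_all add: proj_act_proj_point cn skip_def\<close>)
  qed
  then show ?thesis
    using s(1) card by (intro that[of s 0]) auto
next
  case True
  define m where "m = CARD('m)"
  \<comment> \<open>In the basis with \<open>b\<close> in place of \<open>c j\<close>, the sum of
    all vectors is \<open>b\<close> plus \<open>c 2\<close>, \<open>c 3\<close> and so on. It does
    not involve \<open>c r\<close>, which may be flipped, and it is symmetric in \<open>c 2\<close>
    and \<open>c 3\<close>.\<close>
  define b where "b = c 0 + c 1"
  define d where "d = c(j := b)"
  define r where "r = 1 - j"
  have r: "r < 2" "r \<noteq> j"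
    using True unfolding r_def by arith+
  have "rowdet d \<noteq> 0"
    using rowdet_upd_sum_two[of j c] c True card by (simp add: d_def b_def)
  moreover have "2 < CARD('m)" "3 < CARD('m)" "r < CARD('m)" "2 \<noteq> (3 :: nat)" "2 \<noteq> r" "3 \<noteq> r"
    using r card by auto
  ultimately obtain s where s: "s \<in> GL_pos" "s *v d 2 = d 3" "s *v d 3 = d 2" "s *v d r = - d r"
    "\<And>i. i < CARD('m) \<Longrightarrow> i \<notin> {2, 3, r} \<Longrightarrow> s *v d i = d i"
    by (rule swap_flip_matrix) (rule that)
  have d: "d i = c i" if "i \<noteq> j" for i
    using that by (simp add: d_def)
  have cr: "s *v c r = - c r"
    using s(4) r by (simp add: d)
  have c23: "s *v c 2 = c 3" "s *v c 3 = c 2"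
    using s(2,3) True by (auto simp: d)
  have ci: "s *v c i = c i" if "4 \<le> i" "i < m" for i
    using s(5)[of i] that True r by (auto simp: d m_def)
  have b: "s *v b = b"
    using s(5)[of j] True r card by (auto simp: d_def m_def)
  have sum: "(\<Sum>i<m. c i) = b + c 2 + c 3 + (\<Sum>i\<in>{4..<m}. c i)"
  proof -
    have "{..<m} = {..<4} \<union> {4..<m}"
      using card by (auto simp: m_def)
    then show ?thesis
      by (simp add: sum.union_disjoint ivl_disj_int b_def numeral_eq_Suc)
  qed
  have a: "s *v (\<Sum>i<m. c i) = (\<Sum>i<m. c i)"
    unfolding sum using b c23 ci
    by (simp add: matrix_vector_right_distrib linear_sum[OF matrix_vector_mul_linear] algebra_simps)
  have cn: "config c l \<noteq> 0" for l
    using config_nonzero[OF _ c] card by simp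
  \<comment> \<open>With an entry below 2 omitted, \<open>c 2\<close> and \<open>c 3\<close> stand
    at positions 1 and 2.\<close>
  have "proj_act s (proj_point (config c (skip j k))) =
      proj_point (config c (skip j (Transposition.transpose 1 (Suc 1) k)))" for k
  proof -
    consider "k = 0" | "k = 1" | "k = 2" | "3 \<le> k"
      by linarith
    then show ?thesis
    proof cases
      case 1
      then have "skip j k = r"
        using True by (auto simp: skip_def r_def)
      then show ?thesis
        using 1 cn[of r] cr r card
        by (simp add: proj_act_proj_point config_def proj_point_uminus Transposition.transpose_def skip_def)
    next
      case 4
      then have l: "skip j k = Suc k"
        using True by (simp add: skip_def)
      have "s *v config c (Suc k) = config c (Suc k)"
        using 4 a b ci[of "Suc k"] by (auto simp: config_def m_def b_def)
      then show ?thesis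
        using 4 cn l by (simp add: proj_act_proj_point Transposition.transpose_def)
    qed (use c23 True cn[of 2] cn[of 3] card in
        \<open>simp_all add: proj_act_proj_point skip_def config_def numeral_eq_Suc\<close>)
  qed
  then show ?thesis
    using s(1) card by (intro that[of s 1]) auto
qed

lemma ae_class_cong:
  assumes "f \<in> bounded_meas M" "g \<in> bounded_meas M" "AE x in M. f x = g x"
  shows "ae_class M f = ae_class M g"
  unfolding ae_class_def
  by (rule equiv_class_eq[OF equiv_ae_rel]) (use assms in \<open>simp add: ae_rel_def\<close>)

section \<open>Nonexistence of the liftings\<close>

theorem mainTheorem4:
  assumes "4 \<le> CARD('m::finite)" and "even CARD('m)"
  shows "\<not> (\<exists>\<Lambda> :: nat \<Rightarrow> ((nat \<Rightarrow> 'm proj) \<Rightarrow> real) set \<Rightarrow> ((nat \<Rightarrow> 'm proj) \<Rightarrow> real).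
    (\<forall>p\<ge>1. linear_lifting (proj_pow p) (\<Lambda> p) \<and>
            strong_lifting (proj_pow p) (proj_pow_top p) (\<Lambda> p) \<and>
            equivariant_lifting p (\<Lambda> p)) \<and>
    (\<forall>p\<ge>1. \<forall>f\<in>bounded_meas (proj_pow p).
        \<Lambda> (Suc p) (ae_class (proj_pow (Suc p)) (coboundary p f)) =
          coboundary p (\<Lambda> p (ae_class (proj_pow p) f))) \<and>
    (\<forall>p\<ge>1. \<forall>\<sigma>. \<sigma> permutes {..<p} \<longrightarrow>
        (\<forall>f\<in>bounded_meas (proj_pow p).
          \<Lambda> p (ae_class (proj_pow p) (permute_coords p \<sigma> f)) =
            permute_coords p \<sigma> (\<Lambda> p (ae_class (proj_pow p) f)))))"
proof (rule notI, elim exE conjE)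
  fix \<Lambda> :: "nat \<Rightarrow> ((nat \<Rightarrow> 'm proj) \<Rightarrow> real) set \<Rightarrow> ((nat \<Rightarrow> 'm proj) \<Rightarrow> real)"
  assume lift: "\<forall>p\<ge>1. linear_lifting (proj_pow p) (\<Lambda> p) \<and>
      strong_lifting (proj_pow p) (proj_pow_top p) (\<Lambda> p) \<and> equivariant_lifting p (\<Lambda> p)"
    and cobd: "\<forall>p\<ge>1. \<forall>f\<in>bounded_meas (proj_pow p).
      \<Lambda> (Suc p) (ae_class (proj_pow (Suc p)) (coboundary p f)) =
        coboundary p (\<Lambda> p (ae_class (proj_pow p) f))"
    and perm: "\<forall>p\<ge>1. \<forall>\<sigma>. \<sigma> permutes {..<p} \<longrightarrow>
      (\<forall>f\<in>bounded_meas (proj_pow p).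
        \<Lambda> p (ae_class (proj_pow p) (permute_coords p \<sigma> f)) =
          permute_coords p \<sigma> (\<Lambda> p (ae_class (proj_pow p) f)))"
  define m where "m = CARD('m)"
  define \<phi> :: "(nat \<Rightarrow> 'm proj) \<Rightarrow> real" where "\<phi> = orient_cochain"
  define f where "f = \<Lambda> (Suc m) (ae_class (proj_pow (Suc m)) \<phi>)"
  have \<phi>: "\<phi> \<in> bounded_meas (proj_pow (Suc m))"
    unfolding \<phi>_def m_def by (rule orient_cochain_bounded_meas)
  have scale: "\<Lambda> (Suc p) (ae_class (proj_pow (Suc p)) (\<lambda>x\<in>space (proj_pow (Suc p)). c * g x)) =
      (\<lambda>x\<in>space (proj_pow (Suc p)). c * \<Lambda> (Suc p) (ae_class (proj_pow (Suc p)) g) x)"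
    if "g \<in> bounded_meas (proj_pow (Suc p))" for p c g
    using lift[rule_format, of "Suc p"] that unfolding linear_lifting_def by auto
  have "f \<in> ae_class (proj_pow (Suc m)) \<phi>"
    using lift[rule_format, of "Suc m"] \<phi>
    by (auto simp: linear_lifting_def f_def Linf_def ae_class_def quotient_def)
  then have f_AE: "AE x in proj_pow (Suc m). \<phi> x = f x"
    by (simp add: ae_class_def ae_rel_def)
  have f_inv: "translate (Suc m) s f = f" if "s \<in> GL_pos" for s
  proof -
    have "\<Lambda> (Suc m) (ae_class (proj_pow (Suc m)) (translate (Suc m) s \<phi>)) = translate (Suc m) s f"
      using lift[rule_format, of "Suc m"] that \<phi> by (simp add: equivariant_lifting_def f_def)
    moreover have "translate (Suc m) s \<phi> = \<phi>"
      unfolding \<phi>_def m_def by (rule translate_orient_cochain[OF assms(2) that])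
    ultimately show ?thesis
      by (simp add: f_def)
  qed
  have f_alt: "permute_coords (Suc m) (Transposition.transpose a b) f =
      (\<lambda>x\<in>space (proj_pow (Suc m)). - f x)" if "a < m" "b < m" "a \<noteq> b" for a b
  proof -
    have "Transposition.transpose a b permutes {..<Suc m}"
      using that by (intro permutes_swap_id) auto
    then have "permute_coords (Suc m) (Transposition.transpose a b) f =
        \<Lambda> (Suc m) (ae_class (proj_pow (Suc m)) (permute_coords (Suc m) (Transposition.transpose a b) \<phi>))"
      using perm[rule_format, of "Suc m"] \<phi> by (simp add: f_def)
    also have "\<dots> = \<Lambda> (Suc m) (ae_class (proj_pow (Suc m)) (\<lambda>x\<in>space (proj_pow (Suc m)). (- 1) * \<phi> x))"
      using permute_orient_cochain[of a b, where 'm='m] assms(2) that by (simp add: \<phi>_def m_def)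
    finally show ?thesis
      unfolding scale[OF \<phi>] by (simp add: f_def)
  qed
  have f_cocycle: "coboundary (Suc m) f y = 0" if "y \<in> space (proj_pow (Suc (Suc m)))" for y
  proof -
    let ?M = "proj_pow (Suc (Suc m)) :: (nat \<Rightarrow> 'm proj) measure"
    have d: "coboundary (Suc m) \<phi> \<in> bounded_meas ?M" "AE x in ?M. coboundary (Suc m) \<phi> x = 0"
      unfolding \<phi>_def m_def
      using coboundary_orient_cochain[where 'm='m] assms(2) by auto
    \<comment> \<open>The zero function is written as a multiple by 0, so that homogeneity gives its
      lifting.\<close>
    have "(\<lambda>x\<in>space ?M. 0 * coboundary (Suc m) \<phi> x) \<in> bounded_meas ?M"
      using bounded_meas_restrict[of "\<lambda>_. 0" "Suc (Suc m)" 0] by simp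
    then have "ae_class ?M (coboundary (Suc m) \<phi>) =
        ae_class ?M (\<lambda>x\<in>space ?M. 0 * coboundary (Suc m) \<phi> x)"
      using d by (intro ae_class_cong) (auto elim: AE_mp)
    then have "coboundary (Suc m) f = (\<lambda>x\<in>space ?M. 0)"
      using cobd[rule_format, of "Suc m" \<phi>] \<phi> scale[OF d(1), of 0] by (simp add: f_def)
    with that show ?thesis
      by simp
  qed
  \<comment> \<open>Two properties that hold almost everywhere are realized at a common tuple, the
    only place where the values of \<open>f\<close> and \<open>\<phi>\<close> are compared.\<close>
  have "\<exists>x\<in>space (proj_pow (Suc m)). \<phi> x = f x \<and> \<phi> x \<noteq> 0"
  proof (rule ccontr)
    assume *: "\<not> (\<exists>x\<in>space (proj_pow (Suc m)). \<phi> x = f x \<and> \<phi> x \<noteq> 0)"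
    have "AE x :: nat \<Rightarrow> 'm proj in proj_pow (Suc m). \<phi> x \<noteq> 0"
      unfolding \<phi>_def m_def by (rule AE_orient_cochain_nonzero)
    with f_AE AE_space have "AE x :: nat \<Rightarrow> 'm proj in proj_pow (Suc m). False"
      by eventually_elim (use * in auto)
    then show False
      by (simp only: not_AE_proj_pow_False)
  qed
  then obtain x where x: "x \<in> space (proj_pow (Suc m))" and fx: "f x \<noteq> 0" and \<phi>x: "\<phi> x \<noteq> 0"
    by auto
  define u where "u k = proj_section (x k)" for k
  have "orient u \<noteq> 0"
    using \<phi>x x by (simp add: \<phi>_def orient_cochain_def u_def[abs_def] m_def)
  then have u1: "rowdet (u(i := u m)) \<noteq> 0" if "i < m" for i
    using that by (auto simp: orient_eq m_def sgn_zero_iff)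
  have u0: "rowdet u \<noteq> 0"
    using \<open>orient u \<noteq> 0\<close> by (auto simp: orient_eq)
  obtain \<alpha> where \<alpha>: "u m = (\<Sum>i<m. \<alpha> i *\<^sub>R u i)"
    using rowdet_basis[OF u0, of "u m"] by (auto simp: m_def)
  have \<alpha>0: "\<alpha> i \<noteq> 0" if "i < m" for i
    using rowdet_upd_sum[of i u \<alpha>, folded m_def, folded \<alpha>] u1[OF that] that by auto
  \<comment> \<open>Rescaling by the nonzero coordinates of \<open>u m\<close> keeps the points and
    turns \<open>u m\<close> into the sum of the basis, so that \<open>x\<close> becomes the last
    face of the configuration.\<close>
  define c where "c i = \<alpha> i *\<^sub>R u i" for i
  have c: "rowdet c \<noteq> 0"
    using u0 \<alpha>0 rowdet_scaleR[of \<alpha> u] by (auto simp: c_def[abs_def] m_def)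
  define y where "y = (\<lambda>k\<in>{..<Suc (Suc m)}. proj_point (config c k))"
  have y: "y \<in> space (proj_pow (Suc (Suc m)))"
    by (auto simp: y_def space_proj_pow)
  have last: "omit (Suc m) (Suc m) y = x"
  proof
    fix k
    have "proj_point (config c k) = x k" if "k \<le> m"
      using that \<alpha>0 proj_point_section[of "x k"] \<alpha>
      by (cases "k < m") (auto simp: config_def c_def m_def[symmetric] proj_point_scaleR u_def)
    moreover have "x k = undefined" if "\<not> k \<le> m"
      using x that by (auto simp: space_proj_pow PiE_iff extensional_def)
    ultimately show "omit (Suc m) (Suc m) y k = x k"
      by (auto simp: omit_eq skip_def y_def)
  qed
  have zero: "f (omit (Suc m) j y) = 0" if j: "j \<le> m" for j
  proof -
    obtain s a where s: "s \<in> GL_pos" and a: "Suc a < m"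
      and act: "\<And>k. k \<le> m \<Longrightarrow> proj_act s (proj_point (config c (skip j k))) =
        proj_point (config c (skip j (Transposition.transpose a (Suc a) k)))"
      using config_face_symmetry[OF assms(1) c, of j] j by (auto simp: m_def)
    show ?thesis
    proof (rule alternating_invariant_vanishes[OF f_inv[OF s] s f_alt])
      show "omit (Suc m) j y \<in> space (proj_pow (Suc m))"
        by (auto simp: omit_eq space_proj_pow)
      fix k assume k: "k < Suc m"
      moreover have "Transposition.transpose a (Suc a) k < Suc m"
        using k a by (auto simp: Transposition.transpose_def)
      ultimately show "proj_act s (omit (Suc m) j y k) =
          omit (Suc m) j y (Transposition.transpose a (Suc a) k)"
        using act[of k] by (simp add: omit_eq y_def skip_def)
    qed (use a in auto)
  qed
  \<comment> \<open>Only the face that omits the last point survives in the cocycle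
    relation.\<close>
  have "0 = (\<Sum>j=0..Suc m. (- 1) ^ j * f (omit (Suc m) j y))"
    using f_cocycle[OF y] y by (simp add: coboundary_def)
  also have "\<dots> = (- 1) ^ Suc m * f x"
    using zero by (simp add: last)
  finally show False
    using fx by simp
qed

end
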